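(* There are a fixed doubly exponential function $g$ (i.e. $g(n)\le 2^{2^{p(n)}}$ for a polynomial $p$) and a fixed singly exponential function $f$ (i.e. $f(n)\le 2^{p(n)}$) such that: (i) for every navigational signature $\sigma_{nav}\subseteq\{\downarrow,\downarrow_+,\rightarrow,\rightarrow^+\}$, every $\mathrm{F}_1[\sigma_{nav}]$ formula $\varphi$ satisfiable over trees has a tree model in which all horizontal and vertical paths have length at most $g(|\varphi|)$; (ii) every $\mathrm{F}_1[\downarrow,\downarrow_+,\rightarrow^+]$ formula $\varphi$ satisfiable over trees has a tree model in which horizontal paths have length at most $f(|\varphi|)$ and vertical paths have length at most $g(|\varphi|)$; (iii) every $\mathrm{F}_1[\downarrow_+,\rightarrow,\rightarrow^+]$ formula $\varphi$ satisfiable over trees has a tree model in which vertical paths have length at most $f(|\varphi|)$ and horizontal paths have length at most $g(|\varphi|)$; (iv) every $\mathrm{F}_1[\downarrow_+,\rightarrow^+]$ formula $\varphi$ satisfiable over trees has a tree model in which vertical and horizontal paths have length at most $f(|\varphi|)$.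
   Context: Let $\mathbb N^*$ be the set of finite sequences of naturals. A tree is a finite structure whose universe $T\subseteq\mathbb N^*$ satisfies: if $\langle\alpha,i\rangle\in T$ then $\alpha\in T$ and, if $i>0$, $\langle\alpha,i-1\rangle\in T$; it interprets finitely many unary predicates arbitrarily and the navigational relations present in the signature as: $a\downarrow b$ (child) iff $b=\langle a,i\rangle$; $a\downarrow_+ b$ (descendant) iff $b=\langle a,\beta\rangle$, $\beta$ nonempty; $a\rightarrow b$ (next sibling) iff $a=\langle\alpha,i\rangle,b=\langle\alpha,i+1\rangle$; $a\rightarrow^+b$ (following sibling) iff $a=\langle\alpha,i\rangle,b=\langle\alpha,j\rangle$, $i<j$. A vertical path is a chain $\epsilon,\langle i_1\rangle,\langle i_1,i_2\rangle,\dots,\langle i_1,\dots,i_l\rangle$ from the root to a leaf; a horizontal path is the chain $\langle\alpha,0\rangle,\langle\alpha,1\rangle,\dots,\langle\alpha,l\rangle$ of all children of a node $\alpha$ in order; its length is its number of elements. $\mathrm{F}_1[\sigma_{nav}]$ is the one-dimensional fragment over unary predicates and $\sigma_{nav}$: the smallest set of first-order formulas containing atoms and equalities, closed under $\vee,\neg$, and such that if $\varphi$ has free variables among $x_0,\dots,x_k$ then $\exists x_0\dots x_k\varphi$ and $\exists x_1\dots x_k\varphi$ are in it. $|\varphi|$ is the length of $\varphi$. *)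

theory Defs
  imports Main "HOL-Computational_Algebra.Polynomial"
begin

text \<open>Nodes are finite sequences of naturals; \<open>\<langle>\<alpha>, i\<rangle>\<close> is written \<open>\<alpha> @ [i]\<close>, the root is \<open>[]\<close>.\<close>

type_synonym node = "nat list"

text \<open>Only finitely many unary predicate symbols may have a nonempty interpretation: a structure
  over a finite unary signature interprets all other symbols by the empty set. The navigational
  relations are determined by the nodes and so are not part of the record.\<close>

record tree_struct =
  univ :: "node set"
  pred_int :: "nat \<Rightarrow> node set"

definition is_tree :: "tree_struct \<Rightarrow> bool" where
  "is_tree M \<longleftrightarrow>
     finite (univ M) \<and> univ M \<noteq> {} \<and>
     (\<forall>\<alpha> i. \<alpha> @ [i] \<in> univ M \<longrightarrow> \<alpha> \<in> univ M \<and> (i > 0 \<longrightarrow> \<alpha> @ [i - 1] \<in> univ M)) \<and>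
     (\<forall>p. pred_int M p \<subseteq> univ M) \<and>
     finite {p. pred_int M p \<noteq> {}}"

datatype nav = Child | Desc | NextSib | FollSib

fun nav_rel :: "nav \<Rightarrow> node \<Rightarrow> node \<Rightarrow> bool" where
  "nav_rel Child a b \<longleftrightarrow> (\<exists>i. b = a @ [i])"
| "nav_rel Desc a b \<longleftrightarrow> (\<exists>\<beta>. \<beta> \<noteq> [] \<and> b = a @ \<beta>)"
| "nav_rel NextSib a b \<longleftrightarrow> (\<exists>\<alpha> i. a = \<alpha> @ [i] \<and> b = \<alpha> @ [i + 1])"
| "nav_rel FollSib a b \<longleftrightarrow> (\<exists>\<alpha> i j. a = \<alpha> @ [i] \<and> b = \<alpha> @ [j] \<and> i < j)"

definition leaf :: "tree_struct \<Rightarrow> node \<Rightarrow> bool" where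
  "leaf M a \<longleftrightarrow> a \<in> univ M \<and> (\<forall>b\<in>univ M. \<not> nav_rel Child a b)"

text \<open>Paths are lists of nodes, so the number of elements of a path is its list length.\<close>

definition vertical_path :: "tree_struct \<Rightarrow> node list \<Rightarrow> bool" where
  "vertical_path M ps \<longleftrightarrow>
     (\<exists>w. leaf M w \<and> ps = map (\<lambda>k. take k w) [0..<length w + 1])"

definition horizontal_path :: "tree_struct \<Rightarrow> node list \<Rightarrow> bool" where
  "horizontal_path M ps \<longleftrightarrow>
     (\<exists>\<alpha>\<in>univ M. \<exists>l. ps = map (\<lambda>i. \<alpha> @ [i]) [0..<l + 1] \<and>
        set ps = {b \<in> univ M. nav_rel Child \<alpha> b})"

text \<open>First-order formulas; variables and unary predicate symbols are natural numbers.\<close>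

datatype fo =
    Pred nat nat
  | Nav nav nat nat
  | Eq nat nat
  | Neg fo
  | Or fo fo
  | Ex nat fo

fun fv :: "fo \<Rightarrow> nat set" where
  "fv (Pred p x) = {x}"
| "fv (Nav r x y) = {x, y}"
| "fv (Eq x y) = {x, y}"
| "fv (Neg \<phi>) = fv \<phi>"
| "fv (Or \<phi> \<psi>) = fv \<phi> \<union> fv \<psi>"
| "fv (Ex x \<phi>) = fv \<phi> - {x}"

text \<open>Length in symbols: every occurrence of a predicate symbol, variable, connective or quantifier
  counts one, and parentheses are not counted.\<close>

fun fo_length :: "fo \<Rightarrow> nat" where
  "fo_length (Pred p x) = 2"
| "fo_length (Nav r x y) = 3"
| "fo_length (Eq x y) = 3"
| "fo_length (Neg \<phi>) = 1 + fo_length \<phi>"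
| "fo_length (Or \<phi> \<psi>) = 1 + fo_length \<phi> + fo_length \<psi>"
| "fo_length (Ex x \<phi>) = 2 + fo_length \<phi>"

fun sat :: "tree_struct \<Rightarrow> (nat \<Rightarrow> node) \<Rightarrow> fo \<Rightarrow> bool" where
  "sat M v (Pred p x) \<longleftrightarrow> v x \<in> pred_int M p"
| "sat M v (Nav r x y) \<longleftrightarrow> nav_rel r (v x) (v y)"
| "sat M v (Eq x y) \<longleftrightarrow> v x = v y"
| "sat M v (Neg \<phi>) \<longleftrightarrow> \<not> sat M v \<phi>"
| "sat M v (Or \<phi> \<psi>) \<longleftrightarrow> sat M v \<phi> \<or> sat M v \<psi>"
| "sat M v (Ex x \<phi>) \<longleftrightarrow> (\<exists>a\<in>univ M. sat M (v(x := a)) \<phi>)"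

text \<open>Formulas may have free variables; a model is a tree satisfying the formula under some
  assignment of its nodes to the variables.\<close>

definition tree_model :: "tree_struct \<Rightarrow> fo \<Rightarrow> bool" where
  "tree_model M \<phi> \<longleftrightarrow> is_tree M \<and> (\<exists>v. range v \<subseteq> univ M \<and> sat M v \<phi>)"

definition satisfiable_over_trees :: "fo \<Rightarrow> bool" where
  "satisfiable_over_trees \<phi> \<longleftrightarrow> (\<exists>M. tree_model M \<phi>)"

definition exists_block :: "nat list \<Rightarrow> fo \<Rightarrow> fo" where
  "exists_block xs \<phi> = foldr Ex xs \<phi>"

text \<open>The one-dimensional fragment. In the block rules \<open>x # xs\<close> plays the role of
  \<open>x\<^sub>0, \<dots>, x\<^sub>k\<close>.\<close>

inductive_set F1 :: "nav set \<Rightarrow> fo set" for \<sigma> :: "nav set" where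
  F1_Pred: "Pred p x \<in> F1 \<sigma>"
| F1_Nav: "r \<in> \<sigma> \<Longrightarrow> Nav r x y \<in> F1 \<sigma>"
| F1_Eq: "Eq x y \<in> F1 \<sigma>"
| F1_Neg: "\<phi> \<in> F1 \<sigma> \<Longrightarrow> Neg \<phi> \<in> F1 \<sigma>"
| F1_Or: "\<phi> \<in> F1 \<sigma> \<Longrightarrow> \<psi> \<in> F1 \<sigma> \<Longrightarrow> Or \<phi> \<psi> \<in> F1 \<sigma>"
| F1_Ex_all: "\<phi> \<in> F1 \<sigma> \<Longrightarrow> distinct (x # xs) \<Longrightarrow> fv \<phi> \<subseteq> set (x # xs) \<Longrightarrow>
    exists_block (x # xs) \<phi> \<in> F1 \<sigma>"
| F1_Ex_but_one: "\<phi> \<in> F1 \<sigma> \<Longrightarrow> distinct (x # xs) \<Longrightarrow> fv \<phi> \<subseteq> set (x # xs) \<Longrightarrow>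
    exists_block xs \<phi> \<in> F1 \<sigma>"

text \<open>A polynomial bound with real or integer coefficients is dominated on the naturals by one with
  natural coefficients, so \<open>nat poly\<close> loses nothing.\<close>

definition singly_exponential :: "(nat \<Rightarrow> nat) \<Rightarrow> bool" where
  "singly_exponential f \<longleftrightarrow> (\<exists>p :: nat poly. \<forall>n. f n \<le> 2 ^ poly p n)"

definition doubly_exponential :: "(nat \<Rightarrow> nat) \<Rightarrow> bool" where
  "doubly_exponential g \<longleftrightarrow> (\<exists>p :: nat poly. \<forall>n. g n \<le> 2 ^ (2 ^ poly p n))"

definition vertical_bounded :: "tree_struct \<Rightarrow> nat \<Rightarrow> bool" where
  "vertical_bounded M b \<longleftrightarrow> (\<forall>ps. vertical_path M ps \<longrightarrow> length ps \<le> b)"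

definition horizontal_bounded :: "tree_struct \<Rightarrow> nat \<Rightarrow> bool" where
  "horizontal_bounded M b \<longleftrightarrow> (\<forall>ps. horizontal_path M ps \<longrightarrow> length ps \<le> b)"

end

(*
  The labels of a node are the subformulas with at most one free variable that hold at it. If a
  smaller tree realizes at each of its nodes the same quantifier-free types of labelled tuples as
  the original tree, it satisfies the same one-dimensional formulas. A cut (alpha, i) splits a tree
  into the forest of all subtrees rooted at children of alpha with index at least i, and the rest;
  relations across the cut depend only on a few unary marks. Hence if two nested cuts agree on the
  sets of types of tuples realized on either side (their profiles), the larger forest can be replaced
  by the smaller one. So in a model with the fewest nodes the profiles along a path are distinct,
  and there are doubly exponentially many profiles, but only singly exponentially many types.
  Moving down a branch in the absence of Child, or along siblings in the absence of NextSib, the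
  required marks are stable, so one profile grows and the other shrinks, and a monotone chain of
  profiles is no longer than the number of types.
*)

theory Submission
  imports Defs "HOL-Library.Sublist"
begin

section \<open>Subformulas, variables and blocks of existential quantifiers\<close>

section \<open>Syntax\<close>

fun subs :: "fo \<Rightarrow> fo set" where
  "subs (Pred p x) = {Pred p x}"
| "subs (Nav r x y) = {Nav r x y}"
| "subs (Eq x y) = {Eq x y}"
| "subs (Neg \<phi>) = insert (Neg \<phi>) (subs \<phi>)"
| "subs (Or \<phi> \<psi>) = insert (Or \<phi> \<psi>) (subs \<phi> \<union> subs \<psi>)"
| "subs (Ex x \<phi>) = insert (Ex x \<phi>) (subs \<phi>)"

fun vars :: "fo \<Rightarrow> nat set" where
  "vars (Pred p x) = {x}"
| "vars (Nav r x y) = {x, y}"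
| "vars (Eq x y) = {x, y}"
| "vars (Neg \<phi>) = vars \<phi>"
| "vars (Or \<phi> \<psi>) = vars \<phi> \<union> vars \<psi>"
| "vars (Ex x \<phi>) = insert x (vars \<phi>)"

lemma finite_subs: "finite (subs \<phi>)"
  by (induction \<phi>) auto

lemma finite_vars: "finite (vars \<phi>)"
  by (induction \<phi>) auto

lemma card_subs: "card (subs \<phi>) \<le> fo_length \<phi>"
proof (induction \<phi>)
  case (Or \<phi> \<psi>)
  have "card (subs (Or \<phi> \<psi>)) \<le> Suc (card (subs \<phi> \<union> subs \<psi>))"
    by (simp add: card_insert_if finite_subs)
  also have "\<dots> \<le> Suc (card (subs \<phi>) + card (subs \<psi>))"
    using card_Un_le by simp
  finally show ?case using Or by simp
qed (auto simp: card_insert_if finite_subs)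

lemma card_vars: "card (vars \<phi>) \<le> fo_length \<phi>"
proof (induction \<phi>)
  case (Or \<phi> \<psi>)
  then show ?case using card_Un_le[of "vars \<phi>" "vars \<psi>"] by simp
qed (auto simp: card_insert_if finite_vars)

lemma fv_subset_vars: "fv \<phi> \<subseteq> vars \<phi>"
  by (induction \<phi>) auto

lemma subs_refl: "\<phi> \<in> subs \<phi>"
  by (cases \<phi>) auto

lemma subs_exists_block: "subs \<phi> \<subseteq> subs (exists_block xs \<phi>)"
  unfolding exists_block_def by (induction xs) auto

lemma vars_exists_block: "vars (exists_block xs \<phi>) = set xs \<union> vars \<phi>"
  unfolding exists_block_def by (induction xs) auto

lemma fv_exists_block: "fv (exists_block xs \<phi>) = fv \<phi> - set xs"
  unfolding exists_block_def by (induction xs) auto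

lemma sat_cong: "(\<And>x. x \<in> fv \<phi> \<Longrightarrow> v x = w x) \<Longrightarrow> sat M v \<phi> \<longleftrightarrow> sat M w \<phi>"
proof (induction \<phi> arbitrary: v w)
  case (Ex x \<phi>)
  have "sat M (v(x := a)) \<phi> \<longleftrightarrow> sat M (w(x := a)) \<phi>" for a
    by (rule Ex.IH) (use Ex.prems in auto)
  then show ?case by simp
next
  case (Neg \<phi>)
  from Neg.IH[of v w] Neg.prems show ?case by simp
next
  case (Or \<phi> \<psi>)
  from Or.IH(1)[of v w] Or.IH(2)[of v w] Or.prems show ?case by simp
qed simp_all

text \<open>A whole block becomes one choice of an assignment. Taken quantifier by quantifier, the
  intermediate formulas may have several free variables, and the label of a single node would not
  determine them.\<close>

lemma sat_exists_block:
  assumes "range v \<subseteq> univ M"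
  shows "sat M v (exists_block xs \<phi>) \<longleftrightarrow>
    (\<exists>w. range w \<subseteq> univ M \<and> (\<forall>y\<in>fv \<phi> - set xs. w y = v y) \<and> sat M w \<phi>)"
  using assms
proof (induction xs arbitrary: v)
  case Nil
  have "sat M v \<phi>" if "\<forall>y\<in>fv \<phi>. w y = v y" "sat M w \<phi>" for w
    using sat_cong[of \<phi> w v M] that by auto
  with Nil show ?case by (auto simp: exists_block_def)
next
  case (Cons x xs)
  have IH: "sat M (v(x := a)) (exists_block xs \<phi>) \<longleftrightarrow>
    (\<exists>w. range w \<subseteq> univ M \<and> (\<forall>y\<in>fv \<phi> - set xs. w y = (v(x := a)) y) \<and> sat M w \<phi>)"
    if "a \<in> univ M" for a
    by (rule Cons.IH) (use Cons.prems that in auto)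
  have "sat M v (exists_block (x # xs) \<phi>) \<longleftrightarrow>
    (\<exists>a\<in>univ M. sat M (v(x := a)) (exists_block xs \<phi>))"
    by (simp add: exists_block_def)
  also have "\<dots> \<longleftrightarrow> (\<exists>a\<in>univ M. \<exists>w. range w \<subseteq> univ M \<and>
      (\<forall>y\<in>fv \<phi> - set xs. w y = (v(x := a)) y) \<and> sat M w \<phi>)"
    using IH by simp
  also have "\<dots> \<longleftrightarrow>
    (\<exists>w. range w \<subseteq> univ M \<and> (\<forall>y\<in>fv \<phi> - set (x # xs). w y = v y) \<and> sat M w \<phi>)"
    (is "?L \<longleftrightarrow> ?R")
  proof
    assume ?L
    then obtain a w where "a \<in> univ M" "range w \<subseteq> univ M"
      "\<forall>y\<in>fv \<phi> - set xs. w y = (v(x := a)) y" "sat M w \<phi>" by blast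
    then show ?R by (intro exI[of _ w]) auto
  next
    assume ?R
    then obtain w where w: "range w \<subseteq> univ M" "\<forall>y\<in>fv \<phi> - set (x # xs). w y = v y" "sat M w \<phi>"
      by blast
    then have "w x \<in> univ M" by auto
    with w show ?L by (intro bexI[of _ "w x"] exI[of _ w]) auto
  qed
  finally show ?case .
qed

section \<open>Preservation of one-dimensional formulas by back-and-forth conditions\<close>

section \<open>Invariance of the one-dimensional fragment\<close>

text \<open>\<open>None\<close> encodes equality, so that equality patterns and navigational
  relations are transferred together.\<close>

definition nrel :: "nav option \<Rightarrow> node \<Rightarrow> node \<Rightarrow> bool" where
  "nrel r a b = (case r of None \<Rightarrow> a = b | Some s \<Rightarrow> nav_rel s a b)"

text \<open>The label of a node is the set of subformulas that hold when all variables denote that node;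
  it is meaningful for formulas with at most one free variable. Nodes of the smaller tree are
  labelled by their originals under \<open>h\<close> in the larger tree.\<close>

definition matches ::
  "tree_struct \<Rightarrow> (node \<Rightarrow> node) \<Rightarrow> fo set \<Rightarrow> nav set \<Rightarrow> nat set \<Rightarrow> (nat \<Rightarrow> node) \<Rightarrow> (nat \<Rightarrow> node) \<Rightarrow> bool"
  where
  "matches M h S \<sigma> X w' w \<longleftrightarrow>
     (\<forall>x\<in>X. \<forall>\<psi>\<in>S. sat M (\<lambda>_. h (w' x)) \<psi> \<longleftrightarrow> sat M (\<lambda>_. w x) \<psi>) \<and>
     (\<forall>x\<in>X. \<forall>y\<in>X. \<forall>r\<in>insert None (Some ` \<sigma>). nrel r (w' x) (w' y) \<longleftrightarrow> nrel r (w x) (w y))"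

lemma matches_mono: "matches M h S \<sigma> X w' w \<Longrightarrow> Y \<subseteq> X \<Longrightarrow> matches M h S \<sigma> Y w' w"
  unfolding matches_def by blast

text \<open>A block has at most one free variable, so its truth is a property of one node
  \<open>c\<close>. The hypotheses \<open>zig\<close> and \<open>zag\<close> move a witness tuple
  between the trees while keeping \<open>c\<close> paired with \<open>h c\<close>, and the induction
  hypothesis applies to the matching tuples.\<close>

lemma F1_invariant:
  assumes h: "h ` univ M' \<subseteq> univ M"
    and pred: "\<And>a p. a \<in> univ M' \<Longrightarrow> a \<in> pred_int M' p \<longleftrightarrow> h a \<in> pred_int M p"
    and zig: "\<And>w c. range w \<subseteq> univ M \<Longrightarrow> c \<in> univ M' \<Longrightarrow>
      \<exists>w'. range w' \<subseteq> univ M' \<and> matches M h S \<sigma> V w' w \<and> (\<forall>z\<in>V. w z = h c \<longrightarrow> w' z = c)"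
    and zag: "\<And>w' c. range w' \<subseteq> univ M' \<Longrightarrow> c \<in> univ M' \<Longrightarrow>
      \<exists>w. range w \<subseteq> univ M \<and> matches M h S \<sigma> V w' w \<and> (\<forall>z\<in>V. w' z = c \<longrightarrow> w z = h c)"
    and "\<psi> \<in> F1 \<sigma>" "subs \<psi> \<subseteq> S" "vars \<psi> \<subseteq> V"
    and "range v' \<subseteq> univ M'" "range v \<subseteq> univ M" "matches M h S \<sigma> (fv \<psi>) v' v"
  shows "sat M' v' \<psi> \<longleftrightarrow> sat M v \<psi>"
proof -
  \<comment> \<open>Both quantifier rules of \<open>F1\<close> leave at most \<open>x\<close> free,
    so one claim covers them.\<close>
  have block: "sat M' v' (exists_block xs \<psi>) \<longleftrightarrow> sat M v (exists_block xs \<psi>)"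
    if IH: "\<And>v' v. range v' \<subseteq> univ M' \<Longrightarrow> range v \<subseteq> univ M \<Longrightarrow> matches M h S \<sigma> (fv \<psi>) v' v \<Longrightarrow>
        sat M' v' \<psi> \<longleftrightarrow> sat M v \<psi>"
      and one: "fv (exists_block xs \<psi>) \<subseteq> {x}"
      and S: "subs (exists_block xs \<psi>) \<subseteq> S" and V: "vars (exists_block xs \<psi>) \<subseteq> V"
      and v': "range v' \<subseteq> univ M'" and v: "range v \<subseteq> univ M"
      and m: "matches M h S \<sigma> (fv (exists_block xs \<psi>)) v' v"
    for xs \<psi> x v' v
  proof -
    let ?B = "exists_block xs \<psi>"
    define c where "c = v' x"
    have c: "c \<in> univ M'" using v' by (auto simp: c_def)
    then have hc: "h c \<in> univ M" using h by auto
    have fvV: "fv \<psi> \<subseteq> V" using V fv_subset_vars[of \<psi>] by (auto simp: vars_exists_block)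
    have BS: "?B \<in> S" using S subs_refl by blast
    have fvB: "fv ?B = fv \<psi> - set xs" by (rule fv_exists_block)
    have "sat M v ?B \<longleftrightarrow> sat M (\<lambda>_. v x) ?B"
      by (rule sat_cong) (use one in auto)
    \<comment> \<open>The block lies in \<open>S\<close>, so the labels compared by
      \<open>matches\<close> contain it. If \<open>x\<close> is not free, the block is
      closed.\<close>
    also have "\<dots> \<longleftrightarrow> sat M (\<lambda>_. h c) ?B"
    proof (cases "x \<in> fv ?B")
      case True
      then show ?thesis using m BS by (auto simp: matches_def c_def)
    next
      case False
      then show ?thesis using one by (intro sat_cong) auto
    qed
    also have "\<dots> \<longleftrightarrow> sat M' (\<lambda>_. c) ?B"
    proof
      assume "sat M (\<lambda>_. h c) ?B"
      then obtain w where w: "range w \<subseteq> univ M" "\<forall>y\<in>fv \<psi> - set xs. w y = h c" "sat M w \<psi>"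
        using sat_exists_block[of "\<lambda>_. h c" M xs \<psi>] hc by auto
      obtain w' where w': "range w' \<subseteq> univ M'" "matches M h S \<sigma> V w' w" "\<forall>z\<in>V. w z = h c \<longrightarrow> w' z = c"
        using zig[OF w(1) c] by blast
      have "sat M' w' \<psi>"
        using IH[OF w'(1) w(1) matches_mono[OF w'(2) fvV]] w(3) by simp
      moreover have "\<forall>y\<in>fv \<psi> - set xs. w' y = c" using w(2) w'(3) fvV by auto
      ultimately show "sat M' (\<lambda>_. c) ?B"
        using sat_exists_block[of "\<lambda>_. c" M' xs \<psi>] c w'(1) by auto
    next
      assume "sat M' (\<lambda>_. c) ?B"
      then obtain w' where w': "range w' \<subseteq> univ M'" "\<forall>y\<in>fv \<psi> - set xs. w' y = c" "sat M' w' \<psi>"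
        using sat_exists_block[of "\<lambda>_. c" M' xs \<psi>] c by auto
      obtain w where w: "range w \<subseteq> univ M" "matches M h S \<sigma> V w' w" "\<forall>z\<in>V. w' z = c \<longrightarrow> w z = h c"
        using zag[OF w'(1) c] by blast
      have "sat M w \<psi>"
        using IH[OF w'(1) w(1) matches_mono[OF w(2) fvV]] w'(3) by simp
      moreover have "\<forall>y\<in>fv \<psi> - set xs. w y = h c" using w'(2) w(3) fvV by auto
      ultimately show "sat M (\<lambda>_. h c) ?B"
        using sat_exists_block[of "\<lambda>_. h c" M xs \<psi>] hc w(1) by auto
    qed
    also have "\<dots> \<longleftrightarrow> sat M' v' ?B"
      by (rule sat_cong) (use one in \<open>auto simp: c_def\<close>)
    finally show ?thesis by simp
  qed
  show ?thesis
    using assms(5-)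
  proof (induction arbitrary: v' v rule: F1.induct)
    case (F1_Pred p x)
    then have "sat M (\<lambda>_. h (v' x)) (Pred p x) \<longleftrightarrow> sat M (\<lambda>_. v x) (Pred p x)"
      unfolding matches_def by auto
    moreover have "v' x \<in> univ M'" using F1_Pred by auto
    ultimately show ?case using pred by simp
  next
    case (F1_Nav r x y)
    then have "nrel (Some r) (v' x) (v' y) \<longleftrightarrow> nrel (Some r) (v x) (v y)"
      unfolding matches_def by auto
    then show ?case by (simp add: nrel_def)
  next
    case (F1_Eq x y)
    then have "nrel None (v' x) (v' y) \<longleftrightarrow> nrel None (v x) (v y)"
      unfolding matches_def by auto
    then show ?case by (simp add: nrel_def)
  next
    case (F1_Neg \<psi>)
    then show ?case by simp
  next
    case (F1_Or \<psi> \<chi>)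
    have "matches M h S \<sigma> (fv \<psi>) v' v" "matches M h S \<sigma> (fv \<chi>) v' v"
      using F1_Or.prems by (auto intro: matches_mono)
    then show ?case using F1_Or by simp
  next
    case (F1_Ex_all \<psi> x xs)
    show ?case
    proof (rule block[where x = x])
      show "fv (exists_block (x # xs) \<psi>) \<subseteq> {x}"
        using F1_Ex_all.hyps by (auto simp: fv_exists_block)
      show "sat M' v' \<psi> \<longleftrightarrow> sat M v \<psi>"
        if "range v' \<subseteq> univ M'" "range v \<subseteq> univ M" "matches M h S \<sigma> (fv \<psi>) v' v" for v' v
        using F1_Ex_all.IH F1_Ex_all.prems(1,2) that subs_exists_block[of \<psi> "x # xs"]
        by (auto simp: vars_exists_block)
    qed (use F1_Ex_all.prems in auto)
  next
    case (F1_Ex_but_one \<psi> x xs)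
    show ?case
    proof (rule block[where x = x])
      show "fv (exists_block xs \<psi>) \<subseteq> {x}"
        using F1_Ex_but_one.hyps by (auto simp: fv_exists_block)
      show "sat M' v' \<psi> \<longleftrightarrow> sat M v \<psi>"
        if "range v' \<subseteq> univ M'" "range v \<subseteq> univ M" "matches M h S \<sigma> (fv \<psi>) v' v" for v' v
        using F1_Ex_but_one.IH F1_Ex_but_one.prems(1,2) that subs_exists_block[of \<psi> xs]
        by (auto simp: vars_exists_block)
    qed (use F1_Ex_but_one.prems in auto)
  qed
qed

section \<open>Cuts, relations across them, and moving a forest\<close>

section \<open>Forests below a cut\<close>

text \<open>The forest is taken among all addresses, independently of a tree. For
  \<open>i = 0\<close> it consists of all proper descendants of \<open>\<alpha>\<close>.\<close>

definition below :: "node \<Rightarrow> nat \<Rightarrow> node set" where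
  "below \<alpha> i = {\<alpha> @ m # \<beta> | m \<beta>. i \<le> m}"

text \<open>The marks of a node relative to a cut record how it is related to nodes on the other side.\<close>

datatype mark = Anc | Par | Sib | Prev | First

text \<open>\<open>Anc\<close>, \<open>Par\<close> and \<open>Prev\<close> can hold only outside the
  forest and \<open>First\<close> only inside, whereas \<open>Sib\<close> occurs on both
  sides.\<close>

fun mark_holds :: "node \<Rightarrow> nat \<Rightarrow> mark \<Rightarrow> node \<Rightarrow> bool" where
  "mark_holds \<alpha> i Anc a \<longleftrightarrow> prefix a \<alpha>"
| "mark_holds \<alpha> i Par a \<longleftrightarrow> a = \<alpha>"
| "mark_holds \<alpha> i Sib a \<longleftrightarrow> (\<exists>m. a = \<alpha> @ [m])"
| "mark_holds \<alpha> i Prev a \<longleftrightarrow> (\<exists>j. i = Suc j \<and> a = \<alpha> @ [j])"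
| "mark_holds \<alpha> i First a \<longleftrightarrow> a = \<alpha> @ [i]"

lemma below_iff [simp]: "\<alpha> @ m # \<beta> \<in> below \<alpha> i \<longleftrightarrow> i \<le> m"
  unfolding below_def by auto

lemma below_append: "a \<in> below \<alpha> i \<Longrightarrow> a @ \<gamma> \<in> below \<alpha> i"
  unfolding below_def by auto

lemma self_notin_below [simp]: "\<alpha> \<notin> below \<alpha> i"
  unfolding below_def by auto

lemma snoc_in_below:
  "a @ [n] \<in> below \<alpha> i \<longleftrightarrow> (a = \<alpha> \<and> i \<le> n) \<or> a \<in> below \<alpha> i"
proof
  assume "a @ [n] \<in> below \<alpha> i"
  then obtain m \<beta> where "a @ [n] = \<alpha> @ m # \<beta>" "i \<le> m" unfolding below_def by blast
  then show "(a = \<alpha> \<and> i \<le> n) \<or> a \<in> below \<alpha> i"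
    by (cases \<beta> rule: rev_cases) (auto simp: below_def)
qed (auto intro: below_append)

text \<open>Across a cut each relation splits into a condition on the outer node and one on the
  inner node. No relation leads out of the forest, as it is closed under descendants and following
  siblings.\<close>

lemma nav_rel_across:
  assumes e: "e \<notin> below \<alpha> i" and f: "f \<in> below \<alpha> i"
  shows "nav_rel Child e f \<longleftrightarrow> mark_holds \<alpha> i Par e \<and> mark_holds \<alpha> i Sib f"
    and "nav_rel Desc e f \<longleftrightarrow> mark_holds \<alpha> i Anc e"
    and "nav_rel NextSib e f \<longleftrightarrow> mark_holds \<alpha> i Prev e \<and> mark_holds \<alpha> i First f"
    and "nav_rel FollSib e f \<longleftrightarrow> mark_holds \<alpha> i Sib e \<and> mark_holds \<alpha> i Sib f"
    and "\<not> nav_rel r f e"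
    and "e \<noteq> f"
proof -
  obtain m \<beta> where fm: "f = \<alpha> @ m # \<beta>" "i \<le> m" using f unfolding below_def by blast
  show "nav_rel Child e f \<longleftrightarrow> mark_holds \<alpha> i Par e \<and> mark_holds \<alpha> i Sib f"
    using e f by (auto simp: snoc_in_below)
  show "nav_rel Desc e f \<longleftrightarrow> mark_holds \<alpha> i Anc e"
  proof
    assume "nav_rel Desc e f"
    then obtain \<gamma> where g: "f = e @ \<gamma>" "\<gamma> \<noteq> []" by auto
    \<comment> \<open>A prefix of \<open>f\<close> either is a prefix of \<open>\<alpha>\<close> or
      continues \<open>\<alpha>\<close> with the same index \<open>m\<close>; the latter puts it
      into the forest.\<close>
    have "prefix e \<alpha> \<or> (\<exists>\<delta>. e = \<alpha> @ m # \<delta>)"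
    proof (cases "prefix e \<alpha>")
      case False
      with g fm obtain us where us: "e = \<alpha> @ us" "us @ \<gamma> = m # \<beta>" "us \<noteq> []"
        by (auto simp: append_eq_append_conv2 prefix_def)
      then show ?thesis by (cases us) auto
    qed simp
    with e fm show "mark_holds \<alpha> i Anc e" by auto
  qed (use fm in \<open>auto simp: prefix_def\<close>)
  show "nav_rel NextSib e f \<longleftrightarrow> mark_holds \<alpha> i Prev e \<and> mark_holds \<alpha> i First f"
    using e f by (fastforce simp: snoc_in_below)
  show "nav_rel FollSib e f \<longleftrightarrow> mark_holds \<alpha> i Sib e \<and> mark_holds \<alpha> i Sib f"
    using e f by (fastforce simp: snoc_in_below)
  show "\<not> nav_rel r f e"
    using e f by (cases r) (auto simp: snoc_in_below intro: below_append)
  show "e \<noteq> f" using e f by blast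
qed

text \<open>The marks in \<open>Q\<close> decide the relations of \<open>\<sigma>\<close> across
  cuts with indices \<open>i\<close> and \<open>j\<close>. At index 0 the sibling relations need no
  mark, since no child of the cut node lies outside.\<close>

definition adequate :: "nav set \<Rightarrow> mark set \<Rightarrow> nat \<Rightarrow> nat \<Rightarrow> bool" where
  "adequate \<sigma> Q i j \<longleftrightarrow>
     (Child \<in> \<sigma> \<longrightarrow> Par \<in> Q \<and> Sib \<in> Q) \<and> (Desc \<in> \<sigma> \<longrightarrow> Anc \<in> Q) \<and>
     (NextSib \<in> \<sigma> \<longrightarrow> (Prev \<in> Q \<and> First \<in> Q) \<or> (i = 0 \<and> j = 0)) \<and>
     (FollSib \<in> \<sigma> \<longrightarrow> Sib \<in> Q \<or> (i = 0 \<and> j = 0))"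

lemma nrel_across_eq:
  assumes Q: "adequate \<sigma> Q i j"
    and e: "e \<notin> below \<alpha> i" and f: "f \<in> below \<alpha> i"
    and e': "e' \<notin> below \<alpha>' j" and f': "f' \<in> below \<alpha>' j"
    and ee: "\<And>q. q \<in> Q \<Longrightarrow> mark_holds \<alpha> i q e \<longleftrightarrow> mark_holds \<alpha>' j q e'"
    and ff: "\<And>q. q \<in> Q \<Longrightarrow> mark_holds \<alpha> i q f \<longleftrightarrow> mark_holds \<alpha>' j q f'"
    and r: "r \<in> insert None (Some ` \<sigma>)"
  shows "(nrel r e f \<longleftrightarrow> nrel r e' f') \<and> (nrel r f e \<longleftrightarrow> nrel r f' e')"
proof (cases r)
  case None
  then show ?thesis using e f e' f' by (auto simp: nrel_def)
next
  case (Some s)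
  then have s: "s \<in> \<sigma>" using r by auto
  note across = nav_rel_across[OF e f] nav_rel_across[OF e' f']
  \<comment> \<open>This justifies the exemption for index 0: the marks that the sibling relations
    require of an outer node fail there.\<close>
  have zero: "\<not> mark_holds \<alpha> 0 Prev e" "i = 0 \<Longrightarrow> \<not> mark_holds \<alpha> i Sib e"
    "\<not> mark_holds \<alpha>' 0 Prev e'" "j = 0 \<Longrightarrow> \<not> mark_holds \<alpha>' j Sib e'"
    using e e' by auto
  have "nav_rel s e f \<longleftrightarrow> nav_rel s e' f'"
    using Q s ee ff zero unfolding adequate_def
    by (cases s) (auto simp only: across)
  then show ?thesis using across(5,11) Some by (auto simp: nrel_def)
qed

text \<open>Entry \<open>length \<alpha>\<close> of a node in the forest is the index of its root;
  it is at least \<open>i\<close>, so the subtraction is exact.\<close>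

definition shift :: "node \<Rightarrow> nat \<Rightarrow> node \<Rightarrow> nat \<Rightarrow> node \<Rightarrow> node" where
  "shift \<alpha> i \<alpha>' i' x =
     (if x \<in> below \<alpha> i then \<alpha>' @ (x ! length \<alpha> - i + i') # drop (Suc (length \<alpha>)) x else x)"

lemma shift_outside [simp]: "x \<notin> below \<alpha> i \<Longrightarrow> shift \<alpha> i \<alpha>' i' x = x"
  by (simp add: shift_def)

lemma shift_append [simp]:
  "i \<le> m \<Longrightarrow> shift \<alpha> i \<alpha>' i' (\<alpha> @ m # \<beta>) = \<alpha>' @ (m - i + i') # \<beta>"
  by (simp add: shift_def nth_append)

lemma shift_in_below: "x \<in> below \<alpha> i \<Longrightarrow> shift \<alpha> i \<alpha>' i' x \<in> below \<alpha>' i'"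
  by (auto simp: shift_def)

text \<open>A node of the first forest is moved and brought back; any other node stays in place and
  must not be moved by the second map.\<close>

lemma shift_shift:
  assumes "x \<in> below \<alpha> i \<or> x \<notin> below \<alpha>' i'"
  shows "shift \<alpha>' i' \<alpha> i (shift \<alpha> i \<alpha>' i' x) = x"
proof (cases "x \<in> below \<alpha> i")
  case True
  then obtain m \<beta> where "x = \<alpha> @ m # \<beta>" "i \<le> m" unfolding below_def by blast
  then show ?thesis by simp
qed (use assms in simp)

lemma mark_shift:
  assumes "f \<in> below \<alpha> i"
  shows "mark_holds \<alpha>' i' q (shift \<alpha> i \<alpha>' i' f) \<longleftrightarrow> mark_holds \<alpha> i q f"
proof -
  obtain m \<beta> where "f = \<alpha> @ m # \<beta>" "i \<le> m" using assms unfolding below_def by blast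
  then show ?thesis by (cases q) (auto simp: prefix_def)
qed

lemma nrel_append:
  "nrel r (\<alpha> @ m # \<beta>) (\<alpha> @ n # \<gamma>) \<longleftrightarrow> nrel r (m # \<beta>) (n # \<gamma>)"
proof (cases r)
  case (Some s)
  have ex: "(\<exists>\<delta> j. \<alpha> @ m # \<beta> = \<delta> @ [j] \<and> P \<delta> j) \<longleftrightarrow> (\<exists>\<delta> j. m # \<beta> = \<delta> @ [j] \<and> P (\<alpha> @ \<delta>) j)" for P
    by (cases "m # \<beta>" rule: rev_cases) auto
  show ?thesis
  proof (cases s)
    case NextSib
    then show ?thesis using Some ex[of "\<lambda>\<delta> j. \<alpha> @ n # \<gamma> = \<delta> @ [j + 1]"] by (simp add: nrel_def)
  next
    case FollSib
    then show ?thesis using Some ex[of "\<lambda>\<delta> j. \<exists>k. \<alpha> @ n # \<gamma> = \<delta> @ [k] \<and> j < k"]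
      by (simp add: nrel_def)
  qed (use Some in \<open>simp_all add: nrel_def\<close>)
qed (simp add: nrel_def)

lemma nrel_offset:
  "nrel r ((m + d) # \<beta>) ((n + d) # \<gamma>) \<longleftrightarrow> nrel r (m # \<beta>) (n # \<gamma>)"
proof (cases r)
  case (Some s)
  then show ?thesis by (cases s) (auto simp: nrel_def Cons_eq_append_conv)
qed (auto simp: nrel_def)

lemma nrel_shift:
  assumes "a \<in> below \<alpha> i" "b \<in> below \<alpha> i"
  shows "nrel r (shift \<alpha> i \<alpha>' i' a) (shift \<alpha> i \<alpha>' i' b) \<longleftrightarrow> nrel r a b"
proof -
  obtain m \<beta> n \<gamma> where "a = \<alpha> @ (m + i) # \<beta>" "b = \<alpha> @ (n + i) # \<gamma>"
    using assms unfolding below_def by (auto simp: le_iff_add add.commute)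
  then show ?thesis by (simp add: nrel_append nrel_offset)
qed

section \<open>Types of labelled tuples and the profiles of the two sides of a cut\<close>

section \<open>Profiles\<close>

definition outer :: "tree_struct \<Rightarrow> node \<Rightarrow> nat \<Rightarrow> node set" where
  "outer M \<alpha> i = univ M - below \<alpha> i"

definition inner :: "tree_struct \<Rightarrow> node \<Rightarrow> nat \<Rightarrow> node set" where
  "inner M \<alpha> i = univ M \<inter> below \<alpha> i"

text \<open>Labels, marks and relations of a tuple are stored as three sets, so types are counted as
  subsets.\<close>

type_synonym qf_type =
  "(nat \<times> fo) set \<times> (nat \<times> mark) set \<times> (nav option \<times> nat \<times> nat) set"

definition qf_type ::
  "tree_struct \<Rightarrow> nat set \<Rightarrow> fo set \<Rightarrow> mark set \<Rightarrow> node \<Rightarrow> nat \<Rightarrow> (nat \<Rightarrow> node) \<Rightarrow> qf_type" where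
  "qf_type M V S Q \<alpha> i w =
     ({(x, \<psi>). x \<in> V \<and> \<psi> \<in> S \<and> sat M (\<lambda>_. w x) \<psi>},
      {(x, q). x \<in> V \<and> q \<in> Q \<and> mark_holds \<alpha> i q (w x)},
      {(r, x, y). x \<in> V \<and> y \<in> V \<and> nrel r (w x) (w y)})"

definition profile ::
  "tree_struct \<Rightarrow> nat set \<Rightarrow> fo set \<Rightarrow> mark set \<Rightarrow> node \<Rightarrow> nat \<Rightarrow> node set \<Rightarrow> qf_type set" where
  "profile M V S Q \<alpha> i Y = qf_type M V S Q \<alpha> i ` {w. w ` V \<subseteq> Y}"

definition similar ::
  "tree_struct \<Rightarrow> fo set \<Rightarrow> mark set \<Rightarrow> node \<Rightarrow> nat \<Rightarrow> node \<Rightarrow> nat \<Rightarrow> node \<Rightarrow> node \<Rightarrow> bool" where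
  "similar M S Q \<alpha> i \<alpha>' i' a b \<longleftrightarrow>
     (\<forall>\<psi>\<in>S. sat M (\<lambda>_. a) \<psi> \<longleftrightarrow> sat M (\<lambda>_. b) \<psi>) \<and>
     (\<forall>q\<in>Q. mark_holds \<alpha> i q a \<longleftrightarrow> mark_holds \<alpha>' i' q b)"

lemma similar_sym: "similar M S Q \<alpha> i \<alpha>' i' a b \<longleftrightarrow> similar M S Q \<alpha>' i' \<alpha> i b a"
  unfolding similar_def by blast

text \<open>Inclusion of profiles yields a partner tuple with the same type. The case
  \<open>r = None\<close> preserves the equality pattern.\<close>

lemma profile_subsetD:
  assumes "profile M V S Q \<alpha> i Y \<subseteq> profile M V S Q \<alpha>' i' Y'" and u: "u ` V \<subseteq> Y"
  shows "\<exists>u'. u' ` V \<subseteq> Y' \<and> (\<forall>x\<in>V. similar M S Q \<alpha> i \<alpha>' i' (u x) (u' x)) \<and>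
    (\<forall>x\<in>V. \<forall>y\<in>V. \<forall>r. nrel r (u x) (u y) \<longleftrightarrow> nrel r (u' x) (u' y))"
proof -
  have "qf_type M V S Q \<alpha> i u \<in> profile M V S Q \<alpha>' i' Y'"
    using assms unfolding profile_def by blast
  then obtain u' where u': "u' ` V \<subseteq> Y'" "qf_type M V S Q \<alpha> i u = qf_type M V S Q \<alpha>' i' u'"
    unfolding profile_def by blast
  from u'(2) have eq:
    "\<And>x \<psi>. x \<in> V \<and> \<psi> \<in> S \<and> sat M (\<lambda>_. u x) \<psi> \<longleftrightarrow> x \<in> V \<and> \<psi> \<in> S \<and> sat M (\<lambda>_. u' x) \<psi>"
    "\<And>x q. x \<in> V \<and> q \<in> Q \<and> mark_holds \<alpha> i q (u x) \<longleftrightarrow>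
       x \<in> V \<and> q \<in> Q \<and> mark_holds \<alpha>' i' q (u' x)"
    "\<And>r x y. x \<in> V \<and> y \<in> V \<and> nrel r (u x) (u y) \<longleftrightarrow> x \<in> V \<and> y \<in> V \<and> nrel r (u' x) (u' y)"
    unfolding qf_type_def by (simp_all add: set_eq_iff)
  show ?thesis
    unfolding similar_def using u'(1) eq by blast
qed

text \<open>Each tuple serves as its own partner, since stable marks leave its type
  unchanged.\<close>

lemma profile_mono:
  assumes "Y \<subseteq> Y'"
    and "\<And>a q. a \<in> Y \<Longrightarrow> q \<in> Q \<Longrightarrow> mark_holds \<alpha> i q a \<longleftrightarrow> mark_holds \<alpha>' i' q a"
  shows "profile M V S Q \<alpha> i Y \<subseteq> profile M V S Q \<alpha>' i' Y'"
proof
  fix t assume "t \<in> profile M V S Q \<alpha> i Y"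
  then obtain w where w: "w ` V \<subseteq> Y" "t = qf_type M V S Q \<alpha> i w"
    unfolding profile_def by blast
  then have "t = qf_type M V S Q \<alpha>' i' w"
    using assms(2) unfolding qf_type_def by blast
  then show "t \<in> profile M V S Q \<alpha>' i' Y'"
    using w(1) assms(1) unfolding profile_def by blast
qed

section \<open>The number of types\<close>

definition qf_types :: "nat set \<Rightarrow> fo set \<Rightarrow> qf_type set" where
  "qf_types V S = Pow (V \<times> S) \<times> Pow (V \<times> UNIV) \<times> Pow (UNIV \<times> V \<times> V)"

lemma profile_subset: "profile M V S Q \<alpha> i Y \<subseteq> qf_types V S"
  unfolding profile_def qf_type_def qf_types_def by auto

lemma UNIV_mark: "UNIV = {Anc, Par, Sib, Prev, First}"
  using mark.exhaust by auto

lemma UNIV_nav_option: "UNIV = {None, Some Child, Some Desc, Some NextSib, Some FollSib}"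
proof -
  have "r \<in> {None, Some Child, Some Desc, Some NextSib, Some FollSib}" for r
  proof (cases r)
    case (Some s)
    then show ?thesis by (cases s) simp_all
  qed simp
  then show ?thesis by blast
qed

lemma finite_UNIV_mark: "finite (UNIV :: mark set)" and card_UNIV_mark: "card (UNIV :: mark set) = 5"
  unfolding UNIV_mark by simp_all

lemma finite_UNIV_nav_option: "finite (UNIV :: nav option set)"
  and card_UNIV_nav_option: "card (UNIV :: nav option set) = 5"
  unfolding UNIV_nav_option by simp_all

lemma finite_qf_types: "finite V \<Longrightarrow> finite S \<Longrightarrow> finite (qf_types V S)"
  unfolding qf_types_def using finite_UNIV_mark finite_UNIV_nav_option by simp

text \<open>Labels contribute \<open>n * n\<close> bits, the five marks \<open>5 * n\<close>, and
  the five relations, counting equality, \<open>5 * n * n\<close>.\<close>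

lemma card_qf_types:
  assumes "finite V" "finite S" "card V \<le> n" "card S \<le> n"
  shows "card (qf_types V S) \<le> 2 ^ (6 * n\<^sup>2 + 5 * n)"
proof -
  have "card (qf_types V S) = 2 ^ (card V * card S + card V * 5 + 5 * (card V * card V))"
    using assms(1,2) card_UNIV_mark card_UNIV_nav_option finite_UNIV_mark finite_UNIV_nav_option
    unfolding qf_types_def by (simp add: card_cartesian_product card_Pow power_add)
  also have "\<dots> \<le> 2 ^ (n * n + n * 5 + 5 * (n * n))"
    using assms(3,4) by (intro power_increasing add_mono mult_mono) auto
  also have "n * n + n * 5 + 5 * (n * n) = 6 * n\<^sup>2 + 5 * n"
    by (simp add: power2_eq_square)
  finally show ?thesis .
qed

section \<open>The smaller tree obtained from two nested cuts with equal profiles\<close>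

section \<open>Replacing a forest\<close>

text \<open>The entries in \<open>E\<close> stay, those in \<open>F\<close> are exchanged as one
  tuple, and relations between the parts survive by \<open>across\<close>. The two relations are
  parameters so that both transfer directions and both cuts are covered.\<close>

lemma exchange_part:
  assumes w: "w ` V \<subseteq> E \<union> F"
    and F: "\<And>u. u ` V \<subseteq> F \<Longrightarrow> \<exists>u'. u' ` V \<subseteq> F' \<and> (\<forall>x\<in>V. sim (u x) (u' x)) \<and>
      (\<forall>x\<in>V. \<forall>y\<in>V. \<forall>r\<in>R. relA r (u x) (u y) \<longleftrightarrow> relB r (u' x) (u' y))"
    and E: "\<And>r a b. r \<in> R \<Longrightarrow> a \<in> E \<Longrightarrow> b \<in> E \<Longrightarrow> relA r a b \<longleftrightarrow> relB r a b"
    and across: "\<And>r a b b'. r \<in> R \<Longrightarrow> a \<in> E \<Longrightarrow> b \<in> F \<Longrightarrow> b' \<in> F' \<Longrightarrow> sim b b' \<Longrightarrow>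
      (relA r a b \<longleftrightarrow> relB r a b') \<and> (relA r b a \<longleftrightarrow> relB r b' a)"
  shows "\<exists>w'. w' ` V \<subseteq> E \<union> F' \<and> (\<forall>x\<in>V. w x \<in> E \<longrightarrow> w' x = w x) \<and>
    (\<forall>x\<in>V. w x = w' x \<or> sim (w x) (w' x)) \<and>
    (\<forall>x\<in>V. \<forall>y\<in>V. \<forall>r\<in>R. relA r (w x) (w y) \<longleftrightarrow> relB r (w' x) (w' y))"
proof (cases "w ` V \<subseteq> E")
  case True
  then show ?thesis using E by (intro exI[of _ w]) (auto simp: image_subset_iff)
next
  case False
  then obtain z where z: "z \<in> V" "w z \<notin> E" by blast
  \<comment> \<open>Profiles speak of tuples indexed by all of \<open>V\<close>, so the positions in
    \<open>E\<close> are filled with a node of \<open>F\<close>.\<close>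
  define u where "u x = (if w x \<in> E then w z else w x)" for x
  have "u ` V \<subseteq> F" using w z by (auto simp: u_def)
  then obtain u' where u': "u' ` V \<subseteq> F'" "\<forall>x\<in>V. sim (u x) (u' x)"
    "\<forall>x\<in>V. \<forall>y\<in>V. \<forall>r\<in>R. relA r (u x) (u y) \<longleftrightarrow> relB r (u' x) (u' y)"
    using F by blast
  define w' where "w' x = (if w x \<in> E then w x else u' x)" for x
  have in_F: "w x \<in> F \<and> u' x \<in> F' \<and> sim (w x) (u' x)" if "x \<in> V" "w x \<notin> E" for x
    using that w u'(1) u'(2)[rule_format, OF that(1)] by (auto simp: u_def)
  have rel: "relA r (w x) (w y) \<longleftrightarrow> relB r (w' x) (w' y)" if "x \<in> V" "y \<in> V" "r \<in> R" for x y r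
  proof (cases "w x \<in> E"; cases "w y \<in> E")
    assume "w x \<notin> E" "w y \<notin> E"
    then show ?thesis using u'(3)[rule_format, OF that] by (simp add: u_def w'_def)
  qed (use that E across in_F in \<open>auto simp: w'_def\<close>)
  show ?thesis
    using rel in_F by (intro exI[of _ w']) (auto simp: w'_def)
qed

text \<open>Equal profiles allow the larger forest to be replaced by the smaller one. The conditions
  on \<open>\<alpha>\<close> and its child with index \<open>i - 1\<close> ensure that the result is
  again a tree.\<close>

locale cut =
  fixes M :: tree_struct and V :: "nat set" and S :: "fo set" and \<sigma> :: "nav set"
    and Q :: "mark set" and \<alpha> \<alpha>' :: node and i i' :: nat
  assumes tree: "is_tree M"
    and parent: "\<alpha> \<in> univ M" and pred_sibling: "i > 0 \<Longrightarrow> \<alpha> @ [i - 1] \<in> univ M"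
    and nested: "below \<alpha>' i' \<subseteq> below \<alpha> i"
    and outer_eq: "profile M V S Q \<alpha> i (outer M \<alpha> i) = profile M V S Q \<alpha>' i' (outer M \<alpha>' i')"
    and inner_eq: "profile M V S Q \<alpha> i (inner M \<alpha> i) = profile M V S Q \<alpha>' i' (inner M \<alpha>' i')"
    and adequate: "adequate \<sigma> Q i i'"
begin

abbreviation "h \<equiv> shift \<alpha> i \<alpha>' i'"
abbreviation "k \<equiv> shift \<alpha>' i' \<alpha> i"
abbreviation "R \<equiv> insert None (Some ` \<sigma>)"
abbreviation "kept \<equiv> outer M \<alpha> i \<union> inner M \<alpha>' i'"

text \<open>Addresses in the forest at \<open>(\<alpha>, i)\<close> borrow their nodes from the
  forest at \<open>(\<alpha>', i')\<close>. As a preimage, the structure inherits its predicates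
  through \<open>h\<close>.\<close>

definition M' :: tree_struct where
  "M' = \<lparr>univ = h -` univ M, pred_int = (\<lambda>p. h -` pred_int M p)\<rparr>"

lemma kh: "k (h x) = x"
  using nested by (intro shift_shift) auto

text \<open>The restriction to \<open>kept\<close> is essential: a node of the larger forest outside
  the smaller one is no image of \<open>h\<close>.\<close>

lemma hk: "a \<in> kept \<Longrightarrow> h (k a) = a"
  by (intro shift_shift) (auto simp: outer_def inner_def)

lemma h_kept: "h x \<in> univ M \<longleftrightarrow> h x \<in> kept"
  using shift_in_below[of x \<alpha> i \<alpha>' i'] by (cases "x \<in> below \<alpha> i") (auto simp: outer_def inner_def)

lemma k_outer: "a \<in> outer M \<alpha> i \<Longrightarrow> k a = a"
  using nested by (intro shift_outside) (auto simp: outer_def)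

lemma adequate':
  "adequate \<sigma> Q i i" "adequate \<sigma> Q i' i"
  using adequate by (auto simp: adequate_def)

lemma univ_eq: "outer M \<alpha> i \<union> inner M \<alpha> i = univ M" "inner M \<alpha>' i' \<union> outer M \<alpha>' i' = univ M"
  by (auto simp: outer_def inner_def)

text \<open>Relative to \<open>(\<alpha>, i)\<close>, the shifted node \<open>k b'\<close> has the
  marks of \<open>b'\<close> relative to \<open>(\<alpha>', i')\<close>, and these are the marks of
  \<open>b\<close>. So \<open>b\<close> and \<open>k b'\<close> are related to \<open>a\<close>
  alike.\<close>

lemma across_outer:
  assumes "r \<in> R" "a \<in> outer M \<alpha> i" "b \<in> inner M \<alpha> i" "b' \<in> inner M \<alpha>' i'"
    "similar M S Q \<alpha> i \<alpha>' i' b b'"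
  shows "(nrel r a b \<longleftrightarrow> nrel r (k a) (k b')) \<and> (nrel r b a \<longleftrightarrow> nrel r (k b') (k a))"
proof -
  have "nrel r a b = nrel r a (k b') \<and> nrel r b a = nrel r (k b') a"
    using assms shift_in_below[of b' \<alpha>' i' \<alpha> i]
    by (intro nrel_across_eq[OF adequate'(1), of _ \<alpha> _ _ \<alpha>])
      (auto simp: outer_def inner_def similar_def mark_shift)
  then show ?thesis using k_outer[OF assms(2)] by simp
qed

lemma across_inner:
  assumes "r \<in> R" "a \<in> inner M \<alpha>' i'" "b \<in> outer M \<alpha>' i'" "b' \<in> outer M \<alpha> i"
    "similar M S Q \<alpha>' i' \<alpha> i b b'"
  shows "(nrel r a b \<longleftrightarrow> nrel r (k a) (k b')) \<and> (nrel r b a \<longleftrightarrow> nrel r (k b') (k a))"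
proof -
  have "nrel r b a = nrel r b' (k a) \<and> nrel r a b = nrel r (k a) b'"
    using assms shift_in_below[of a \<alpha>' i' \<alpha> i]
    by (intro nrel_across_eq[OF adequate'(2), of _ \<alpha>' _ _ \<alpha>])
      (auto simp: outer_def inner_def similar_def mark_shift)
  then show ?thesis using k_outer[OF assms(4)] by simp
qed

lemma nrel_k_inner:
  "a \<in> inner M \<alpha>' i' \<Longrightarrow> b \<in> inner M \<alpha>' i' \<Longrightarrow> nrel r (k a) (k b) \<longleftrightarrow> nrel r a b"
  by (intro nrel_shift) (auto simp: inner_def)

lemma nrel_k_outer:
  "a \<in> outer M \<alpha> i \<Longrightarrow> b \<in> outer M \<alpha> i \<Longrightarrow> nrel r (k a) (k b) \<longleftrightarrow> nrel r a b"
  by (simp add: k_outer)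

text \<open>Applying \<open>k\<close> gives addresses in the new tree, so this and the next three
  lemmas compare relations in \<open>M\<close> with relations in \<open>M'\<close>, for either side
  and either direction.\<close>

lemma inner_transfer:
  assumes "u ` V \<subseteq> inner M \<alpha> i"
  shows "\<exists>u'. u' ` V \<subseteq> inner M \<alpha>' i' \<and> (\<forall>x\<in>V. similar M S Q \<alpha> i \<alpha>' i' (u x) (u' x)) \<and>
    (\<forall>x\<in>V. \<forall>y\<in>V. \<forall>r\<in>R. nrel r (u x) (u y) \<longleftrightarrow> nrel r (k (u' x)) (k (u' y)))"
proof -
  obtain u' where u': "u' ` V \<subseteq> inner M \<alpha>' i'" "\<forall>x\<in>V. similar M S Q \<alpha> i \<alpha>' i' (u x) (u' x)"
    "\<forall>x\<in>V. \<forall>y\<in>V. \<forall>r. nrel r (u x) (u y) \<longleftrightarrow> nrel r (u' x) (u' y)"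
    using profile_subsetD[OF equalityD1[OF inner_eq] assms] by blast
  then show ?thesis
    by (intro exI[of _ u']) (simp add: nrel_k_inner image_subset_iff)
qed

lemma inner_transfer':
  assumes "u ` V \<subseteq> inner M \<alpha>' i'"
  shows "\<exists>u'. u' ` V \<subseteq> inner M \<alpha> i \<and> (\<forall>x\<in>V. similar M S Q \<alpha> i \<alpha>' i' (u' x) (u x)) \<and>
    (\<forall>x\<in>V. \<forall>y\<in>V. \<forall>r\<in>R. nrel r (k (u x)) (k (u y)) \<longleftrightarrow> nrel r (u' x) (u' y))"
proof -
  obtain u' where u': "u' ` V \<subseteq> inner M \<alpha> i" "\<forall>x\<in>V. similar M S Q \<alpha>' i' \<alpha> i (u x) (u' x)"
    "\<forall>x\<in>V. \<forall>y\<in>V. \<forall>r. nrel r (u x) (u y) \<longleftrightarrow> nrel r (u' x) (u' y)"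
    using profile_subsetD[OF equalityD2[OF inner_eq] assms] by blast
  then show ?thesis
    using assms similar_sym by (intro exI[of _ u']) (simp add: nrel_k_inner image_subset_iff)
qed

lemma outer_transfer:
  assumes "u ` V \<subseteq> outer M \<alpha>' i'"
  shows "\<exists>u'. u' ` V \<subseteq> outer M \<alpha> i \<and> (\<forall>x\<in>V. similar M S Q \<alpha>' i' \<alpha> i (u x) (u' x)) \<and>
    (\<forall>x\<in>V. \<forall>y\<in>V. \<forall>r\<in>R. nrel r (u x) (u y) \<longleftrightarrow> nrel r (k (u' x)) (k (u' y)))"
proof -
  obtain u' where u': "u' ` V \<subseteq> outer M \<alpha> i" "\<forall>x\<in>V. similar M S Q \<alpha>' i' \<alpha> i (u x) (u' x)"
    "\<forall>x\<in>V. \<forall>y\<in>V. \<forall>r. nrel r (u x) (u y) \<longleftrightarrow> nrel r (u' x) (u' y)"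
    using profile_subsetD[OF equalityD2[OF outer_eq] assms] by blast
  then show ?thesis
    by (intro exI[of _ u']) (simp add: nrel_k_outer image_subset_iff)
qed

lemma outer_transfer':
  assumes "u ` V \<subseteq> outer M \<alpha> i"
  shows "\<exists>u'. u' ` V \<subseteq> outer M \<alpha>' i' \<and> (\<forall>x\<in>V. similar M S Q \<alpha>' i' \<alpha> i (u' x) (u x)) \<and>
    (\<forall>x\<in>V. \<forall>y\<in>V. \<forall>r\<in>R. nrel r (k (u x)) (k (u y)) \<longleftrightarrow> nrel r (u' x) (u' y))"
proof -
  obtain u' where u': "u' ` V \<subseteq> outer M \<alpha>' i'" "\<forall>x\<in>V. similar M S Q \<alpha> i \<alpha>' i' (u x) (u' x)"
    "\<forall>x\<in>V. \<forall>y\<in>V. \<forall>r. nrel r (u x) (u y) \<longleftrightarrow> nrel r (u' x) (u' y)"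
    using profile_subsetD[OF equalityD1[OF outer_eq] assms] by blast
  then show ?thesis
    using assms similar_sym by (intro exI[of _ u']) (simp add: nrel_k_outer image_subset_iff)
qed

text \<open>The side containing \<open>c\<close> stays fixed: \<open>M\<close> is split at the
  larger cut if \<open>c\<close> lies outside it, and at the smaller cut otherwise. The other side
  is exchanged.\<close>

lemma into_kept:
  assumes w: "w ` V \<subseteq> univ M" and c: "c \<in> kept"
  shows "\<exists>w'. w' ` V \<subseteq> kept \<and> (\<forall>x\<in>V. w x = c \<longrightarrow> w' x = c) \<and>
    (\<forall>x\<in>V. \<forall>\<psi>\<in>S. sat M (\<lambda>_. w x) \<psi> \<longleftrightarrow> sat M (\<lambda>_. w' x) \<psi>) \<and>
    (\<forall>x\<in>V. \<forall>y\<in>V. \<forall>r\<in>R. nrel r (w x) (w y) \<longleftrightarrow> nrel r (k (w' x)) (k (w' y)))"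
proof (cases "c \<in> outer M \<alpha> i")
  case True
  from exchange_part[OF w[folded univ_eq(1)],
      where relA = nrel and relB = "\<lambda>r a b. nrel r (k a) (k b)" and R = R,
      OF inner_transfer nrel_k_outer[symmetric] across_outer]
  obtain w' where w': "w' ` V \<subseteq> kept" "\<forall>x\<in>V. w x \<in> outer M \<alpha> i \<longrightarrow> w' x = w x"
    "\<forall>x\<in>V. w x = w' x \<or> similar M S Q \<alpha> i \<alpha>' i' (w x) (w' x)"
    "\<forall>x\<in>V. \<forall>y\<in>V. \<forall>r\<in>R. nrel r (w x) (w y) \<longleftrightarrow> nrel r (k (w' x)) (k (w' y))"
    by blast
  show ?thesis
  proof (intro exI[of _ w'] conjI)
    show "w' ` V \<subseteq> kept" using w'(1) by blast
    show "\<forall>x\<in>V. w x = c \<longrightarrow> w' x = c" using w'(2) True by auto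
    show "\<forall>x\<in>V. \<forall>\<psi>\<in>S. sat M (\<lambda>_. w x) \<psi> \<longleftrightarrow> sat M (\<lambda>_. w' x) \<psi>"
      using w'(3) unfolding similar_def by metis
  qed (fact w'(4))
next
  case False
  from exchange_part[OF w[folded univ_eq(2)],
      where relA = nrel and relB = "\<lambda>r a b. nrel r (k a) (k b)" and R = R,
      OF outer_transfer nrel_k_inner[symmetric] across_inner]
  obtain w' where w': "w' ` V \<subseteq> inner M \<alpha>' i' \<union> outer M \<alpha> i"
    "\<forall>x\<in>V. w x \<in> inner M \<alpha>' i' \<longrightarrow> w' x = w x"
    "\<forall>x\<in>V. w x = w' x \<or> similar M S Q \<alpha>' i' \<alpha> i (w x) (w' x)"
    "\<forall>x\<in>V. \<forall>y\<in>V. \<forall>r\<in>R. nrel r (w x) (w y) \<longleftrightarrow> nrel r (k (w' x)) (k (w' y))"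
    by blast
  show ?thesis
  proof (intro exI[of _ w'] conjI)
    show "w' ` V \<subseteq> kept" using w'(1) by blast
    show "\<forall>x\<in>V. w x = c \<longrightarrow> w' x = c" using w'(2) False c by auto
    show "\<forall>x\<in>V. \<forall>\<psi>\<in>S. sat M (\<lambda>_. w x) \<psi> \<longleftrightarrow> sat M (\<lambda>_. w' x) \<psi>"
      using w'(3) unfolding similar_def by metis
  qed (fact w'(4))
qed

lemma from_kept:
  assumes w: "w ` V \<subseteq> kept" and c: "c \<in> kept"
  shows "\<exists>w'. w' ` V \<subseteq> univ M \<and> (\<forall>x\<in>V. w x = c \<longrightarrow> w' x = c) \<and>
    (\<forall>x\<in>V. \<forall>\<psi>\<in>S. sat M (\<lambda>_. w x) \<psi> \<longleftrightarrow> sat M (\<lambda>_. w' x) \<psi>) \<and>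
    (\<forall>x\<in>V. \<forall>y\<in>V. \<forall>r\<in>R. nrel r (k (w x)) (k (w y)) \<longleftrightarrow> nrel r (w' x) (w' y))"
proof (cases "c \<in> outer M \<alpha> i")
  case True
  have across: "(nrel r (k a) (k b) \<longleftrightarrow> nrel r a b') \<and> (nrel r (k b) (k a) \<longleftrightarrow> nrel r b' a)"
    if "r \<in> R" "a \<in> outer M \<alpha> i" "b \<in> inner M \<alpha>' i'" "b' \<in> inner M \<alpha> i"
      "similar M S Q \<alpha> i \<alpha>' i' b' b" for r a b b'
    using across_outer[OF that(1,2,4,3,5)] by simp
  from exchange_part[OF w, where relB = nrel and relA = "\<lambda>r a b. nrel r (k a) (k b)" and R = R
      and sim = "\<lambda>b b'. similar M S Q \<alpha> i \<alpha>' i' b' b",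
      OF inner_transfer' nrel_k_outer across]
  obtain w' where w': "w' ` V \<subseteq> outer M \<alpha> i \<union> inner M \<alpha> i"
    "\<forall>x\<in>V. w x \<in> outer M \<alpha> i \<longrightarrow> w' x = w x"
    "\<forall>x\<in>V. w x = w' x \<or> similar M S Q \<alpha> i \<alpha>' i' (w' x) (w x)"
    "\<forall>x\<in>V. \<forall>y\<in>V. \<forall>r\<in>R. nrel r (k (w x)) (k (w y)) \<longleftrightarrow> nrel r (w' x) (w' y)"
    by blast
  show ?thesis
  proof (intro exI[of _ w'] conjI)
    show "w' ` V \<subseteq> univ M" using w'(1) by (simp add: univ_eq)
    show "\<forall>x\<in>V. w x = c \<longrightarrow> w' x = c" using w'(2) True by auto
    show "\<forall>x\<in>V. \<forall>\<psi>\<in>S. sat M (\<lambda>_. w x) \<psi> \<longleftrightarrow> sat M (\<lambda>_. w' x) \<psi>"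
      using w'(3) unfolding similar_def by metis
  qed (fact w'(4))
next
  case False
  have w2: "w ` V \<subseteq> inner M \<alpha>' i' \<union> outer M \<alpha> i" using w by blast
  have across: "(nrel r (k a) (k b) \<longleftrightarrow> nrel r a b') \<and> (nrel r (k b) (k a) \<longleftrightarrow> nrel r b' a)"
    if "r \<in> R" "a \<in> inner M \<alpha>' i'" "b \<in> outer M \<alpha> i" "b' \<in> outer M \<alpha>' i'"
      "similar M S Q \<alpha>' i' \<alpha> i b' b" for r a b b'
    using across_inner[OF that(1,2,4,3,5)] by simp
  from exchange_part[OF w2, where relB = nrel and relA = "\<lambda>r a b. nrel r (k a) (k b)" and R = R
      and sim = "\<lambda>b b'. similar M S Q \<alpha>' i' \<alpha> i b' b",
      OF outer_transfer' nrel_k_inner across]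
  obtain w' where w': "w' ` V \<subseteq> inner M \<alpha>' i' \<union> outer M \<alpha>' i'"
    "\<forall>x\<in>V. w x \<in> inner M \<alpha>' i' \<longrightarrow> w' x = w x"
    "\<forall>x\<in>V. w x = w' x \<or> similar M S Q \<alpha>' i' \<alpha> i (w' x) (w x)"
    "\<forall>x\<in>V. \<forall>y\<in>V. \<forall>r\<in>R. nrel r (k (w x)) (k (w y)) \<longleftrightarrow> nrel r (w' x) (w' y)"
    by blast
  show ?thesis
  proof (intro exI[of _ w'] conjI)
    show "w' ` V \<subseteq> univ M" using w'(1) by (simp add: univ_eq)
    show "\<forall>x\<in>V. w x = c \<longrightarrow> w' x = c" using w'(2) False c by auto
    show "\<forall>x\<in>V. \<forall>\<psi>\<in>S. sat M (\<lambda>_. w x) \<psi> \<longleftrightarrow> sat M (\<lambda>_. w' x) \<psi>"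
      using w'(3) unfolding similar_def by metis
  qed (fact w'(4))
qed

lemma is_tree_M': "is_tree M'"
proof -
  have inj: "inj h" using kh by (metis injI)
  have closed: "y \<in> univ M" "j > 0 \<Longrightarrow> y @ [j - 1] \<in> univ M" if "y @ [j] \<in> univ M" for y j
    using that tree unfolding is_tree_def by blast+
  have hy: "h y \<in> univ M \<and> (j > 0 \<longrightarrow> h (y @ [j - 1]) \<in> univ M)" if x: "h (y @ [j]) \<in> univ M" for y j
  proof (cases "y \<in> below \<alpha> i")
    case True
    then obtain m \<beta> where y: "y = \<alpha> @ m # \<beta>" "i \<le> m" unfolding below_def by blast
    then have "h (y @ [n]) = h y @ [n]" for n by simp
    then show ?thesis using x closed by simp
  next
    case y: False
    show ?thesis
    proof (cases "y = \<alpha> \<and> i \<le> j")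
      case True
      then have y\<alpha>: "y = \<alpha>" and ij: "i \<le> j" by auto
      have x': "\<alpha>' @ [j - i + i'] \<in> univ M" using x ij y\<alpha> by simp
      \<comment> \<open>For \<open>j > i\<close> the left sibling is moved along with the node; for
        \<open>j = i\<close> it lies just outside the forest, where \<open>pred_sibling\<close>
        provides it.\<close>
      have "h (\<alpha> @ [j - 1]) \<in> univ M" if "j > 0"
      proof (cases "i \<le> j - 1")
        case True
        then have "h (\<alpha> @ [j - 1]) = \<alpha>' @ [j - i + i' - 1]" using that by simp
        then show ?thesis using closed(2)[OF x'] True that by simp
      next
        case False
        then have "i = j" using ij by simp
        moreover have "h (\<alpha> @ [j - 1]) = \<alpha> @ [j - 1]"
          using False by (intro shift_outside) simp
        ultimately show ?thesis using pred_sibling that by simp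
      qed
      then show ?thesis using y\<alpha> parent by simp
    next
      case False
      then have "y @ [j] \<notin> below \<alpha> i" "y @ [j - 1] \<notin> below \<alpha> i"
        using y by (auto simp: snoc_in_below)
      then show ?thesis using x y closed by simp
    qed
  qed
  have "finite (h -` univ M)" using tree inj by (auto simp: is_tree_def intro: finite_vimageI)
  moreover have "\<alpha> \<in> h -` univ M" using parent by simp
  then have "h -` univ M \<noteq> {}" by blast
  moreover have "{p. h -` pred_int M p \<noteq> {}} \<subseteq> {p. pred_int M p \<noteq> {}}" by auto
  then have "finite {p. h -` pred_int M p \<noteq> {}}"
    using tree finite_subset unfolding is_tree_def by blast
  moreover have "h -` pred_int M p \<subseteq> h -` univ M" for p
    using tree unfolding is_tree_def by blast
  ultimately show ?thesis using hy unfolding is_tree_def M'_def by auto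
qed

text \<open>The map \<open>h\<close> embeds the new tree into \<open>M\<close> and omits
  \<open>z\<close>.\<close>

lemma card_M':
  assumes "z \<in> univ M" "z \<in> below \<alpha> i" "z \<notin> below \<alpha>' i'"
  shows "card (univ M') < card (univ M)"
proof -
  have fin: "finite (univ M)" using tree by (simp add: is_tree_def)
  have "h ` univ M' \<subseteq> univ M - {z}"
  proof
    fix a assume "a \<in> h ` univ M'"
    then have "a \<in> kept" using h_kept by (auto simp: M'_def)
    then show "a \<in> univ M - {z}" using assms by (auto simp: outer_def inner_def)
  qed
  moreover have "inj_on h (univ M')" using kh by (metis inj_onI)
  ultimately have "card (univ M') \<le> card (univ M - {z})"
    using fin by (intro card_inj_on_le) auto
  also have "\<dots> < card (univ M)" using fin assms(1) by (intro card_Diff1_less)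
  finally show ?thesis .
qed

lemma tree_model_M':
  assumes "\<phi> \<in> F1 \<sigma>" "subs \<phi> \<subseteq> S" "vars \<phi> \<subseteq> V" "tree_model M \<phi>"
  shows "tree_model M' \<phi>"
proof -
  obtain v where v: "range v \<subseteq> univ M" "sat M v \<phi>"
    using assms(4) unfolding tree_model_def by blast
  have univ': "x \<in> univ M' \<longleftrightarrow> h x \<in> kept" for x
    using h_kept by (simp add: M'_def)
  have zig: "\<exists>w'. range w' \<subseteq> univ M' \<and> matches M h S \<sigma> V w' w \<and> (\<forall>z\<in>V. w z = h c \<longrightarrow> w' z = c)"
    if w: "range w \<subseteq> univ M" and c: "c \<in> univ M'" for w c
  proof -
    have "w ` V \<subseteq> univ M" using w by blast
    from into_kept[OF this c[unfolded univ']]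
    obtain u where u: "u ` V \<subseteq> kept" "\<forall>x\<in>V. w x = h c \<longrightarrow> u x = h c"
      "\<forall>x\<in>V. \<forall>\<psi>\<in>S. sat M (\<lambda>_. w x) \<psi> \<longleftrightarrow> sat M (\<lambda>_. u x) \<psi>"
      "\<forall>x\<in>V. \<forall>y\<in>V. \<forall>r\<in>R. nrel r (w x) (w y) \<longleftrightarrow> nrel r (k (u x)) (k (u y))"
      by blast
    \<comment> \<open>Assignments are total; outside \<open>V\<close> the node \<open>c\<close> is a
      default value.\<close>
    define w' where "w' x = (if x \<in> V then k (u x) else c)" for x
    have hw': "h (w' x) = u x" if "x \<in> V" for x
      using that u(1) hk[of "u x"] by (auto simp: w'_def)
    have "w' x \<in> univ M'" for x
      using hw'[of x] u(1) c by (cases "x \<in> V") (auto simp: univ' w'_def)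
    then have "range w' \<subseteq> univ M'" by blast
    moreover have "matches M h S \<sigma> V w' w"
      unfolding matches_def using u(3,4) hw' by (auto simp: w'_def)
    moreover have "\<forall>z\<in>V. w z = h c \<longrightarrow> w' z = c"
      using u(2) kh by (simp add: w'_def)
    ultimately show ?thesis by blast
  qed
  have zag: "\<exists>w. range w \<subseteq> univ M \<and> matches M h S \<sigma> V w' w \<and> (\<forall>z\<in>V. w' z = c \<longrightarrow> w z = h c)"
    if w': "range w' \<subseteq> univ M'" and c: "c \<in> univ M'" for w' c
  proof -
    have "(\<lambda>x. h (w' x)) ` V \<subseteq> kept" using w' univ' by blast
    from from_kept[OF this c[unfolded univ']]
    obtain u where u: "u ` V \<subseteq> univ M" "\<forall>x\<in>V. h (w' x) = h c \<longrightarrow> u x = h c"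
      "\<forall>x\<in>V. \<forall>\<psi>\<in>S. sat M (\<lambda>_. h (w' x)) \<psi> \<longleftrightarrow> sat M (\<lambda>_. u x) \<psi>"
      "\<forall>x\<in>V. \<forall>y\<in>V. \<forall>r\<in>R. nrel r (w' x) (w' y) \<longleftrightarrow> nrel r (u x) (u y)"
      unfolding kh by blast
    define w where "w x = (if x \<in> V then u x else \<alpha>)" for x
    have "range w \<subseteq> univ M" using u(1) parent by (auto simp: w_def)
    moreover have "matches M h S \<sigma> V w' w"
      unfolding matches_def using u(3,4) by (auto simp: w_def)
    moreover have "\<forall>z\<in>V. w' z = c \<longrightarrow> w z = h c"
      using u(2) by (simp add: w_def)
    ultimately show ?thesis by blast
  qed
  \<comment> \<open>To start, only some tuple matching \<open>v\<close> is wanted;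
    \<open>\<alpha>\<close> serves as the anchor for \<open>zig\<close>.\<close>
  have "\<alpha> \<in> univ M'" using parent by (simp add: M'_def)
  then obtain v' where v': "range v' \<subseteq> univ M'" "matches M h S \<sigma> V v' v"
    using zig[OF v(1)] by blast
  have "sat M' v' \<phi> \<longleftrightarrow> sat M v \<phi>"
  proof (rule F1_invariant[OF _ _ zig zag assms(1-3) v'(1) v(1)])
    show "matches M h S \<sigma> (fv \<phi>) v' v"
      using v'(2) fv_subset_vars assms(3) by (blast intro: matches_mono)
  qed (auto simp: M'_def)
  then show ?thesis using v(2) v'(1) is_tree_M' unfolding tree_model_def by blast
qed

end

section \<open>Chains of cuts in a model with the fewest nodes\<close>

section \<open>Counting profiles along a path\<close>

lemma pair_chain_length:
  fixes A B :: "nat \<Rightarrow> 'a set"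
  assumes T: "finite T" "\<And>j. j \<le> l \<Longrightarrow> A j \<subseteq> T" "\<And>j. j \<le> l \<Longrightarrow> B j \<subseteq> T"
    and inj: "inj_on (\<lambda>j. (A j, B j)) {..l}"
  shows "Suc l \<le> 2 ^ (2 * card T)"
proof -
  have "card {..l} \<le> card (Pow T \<times> Pow T)"
    using T by (intro card_inj_on_le[OF inj]) auto
  then show ?thesis
    using T(1) by (simp add: card_cartesian_product card_Pow power_add mult_2)
qed

lemma monotone_pair_chain_length:
  fixes A B :: "nat \<Rightarrow> 'a set"
  assumes T: "finite T" "\<And>j. j \<le> l \<Longrightarrow> A j \<subseteq> T" "\<And>j. j \<le> l \<Longrightarrow> B j \<subseteq> T"
    and inj: "inj_on (\<lambda>j. (A j, B j)) {..l}"
    and mono: "\<And>j m. j < m \<Longrightarrow> m \<le> l \<Longrightarrow> A j \<subseteq> A m" "\<And>j m. j < m \<Longrightarrow> m \<le> l \<Longrightarrow> B m \<subseteq> B j"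
  shows "l \<le> 2 * card T"
proof -
  \<comment> \<open>Later pairs have a larger first or a smaller second set, so this potential grows
    strictly; it never exceeds \<open>2 * card T\<close>.\<close>
  define g where "g j = card (A j) + (card T - card (B j))" for j
  have fin: "finite (A j)" "finite (B j)" if "j \<le> l" for j
    using that T finite_subset by metis+
  have strict: "g j < g m" if "j < m" "m \<le> l" for j m
  proof -
    have "(A j, B j) \<noteq> (A m, B m)"
      using inj_onD[OF inj, of j m] that by auto
    then have "A j \<subset> A m \<or> B m \<subset> B j" using mono[OF that] by blast
    then have "card (A j) < card (A m) \<or> card (B m) < card (B j)"
      using fin[of m] fin[of j] that psubset_card_mono by auto
    moreover have "card (A j) \<le> card (A m)" "card (B m) \<le> card (B j)"
      using fin[of m] fin[of j] that mono[OF that] by (auto intro: card_mono)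
    moreover have "card (B j) \<le> card T" using T that by (intro card_mono) auto
    ultimately show ?thesis by (auto simp: g_def)
  qed
  have "m \<le> g m" if "m \<le> l" for m
    using that
  proof (induction m)
    case (Suc m)
    then show ?case using strict[of m "Suc m"] by simp
  qed simp
  from this[of l] have "l \<le> g l" by simp
  also have "\<dots> \<le> card T + card T"
    using T by (auto simp: g_def intro!: add_mono card_mono)
  finally show ?thesis by simp
qed

text \<open>Minimality counts all nodes, so one and the same model satisfies the vertical and the
  horizontal bounds.\<close>

locale minimal_model =
  fixes \<sigma> :: "nav set" and \<phi> :: fo and M :: tree_struct
  assumes F1: "\<phi> \<in> F1 \<sigma>"
    and model: "tree_model M \<phi>"
    and minimal: "\<And>N. tree_model N \<phi> \<Longrightarrow> card (univ M) \<le> card (univ N)"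
begin

lemma tree: "is_tree M"
  using model by (simp add: tree_model_def)

lemma prefix_closed: "prefix a b \<Longrightarrow> b \<in> univ M \<Longrightarrow> a \<in> univ M"
proof (induction b rule: rev_induct)
  case (snoc x b)
  then show ?case using tree unfolding is_tree_def by (metis prefix_snoc)
qed simp

abbreviation "prof \<equiv> profile M (vars \<phi>) (subs \<phi>)"
abbreviation "outs Q c \<equiv> prof Q (fst c) (snd c) (outer M (fst c) (snd c))"
abbreviation "ins Q c \<equiv> prof Q (fst c) (snd c) (inner M (fst c) (snd c))"
abbreviation "T \<equiv> qf_types (vars \<phi>) (subs \<phi>)"

text \<open>Any two members satisfy the assumptions of \<open>cut\<close> apart from equality of
  profiles, and a node of \<open>M\<close> separates their forests.\<close>

definition cut_chain :: "mark set \<Rightarrow> nat \<Rightarrow> (nat \<Rightarrow> node \<times> nat) \<Rightarrow> bool" where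
  "cut_chain Q l c \<longleftrightarrow>
     (\<forall>j\<le>l. fst (c j) \<in> univ M \<and> (snd (c j) > 0 \<longrightarrow> fst (c j) @ [snd (c j) - 1] \<in> univ M)) \<and>
     (\<forall>j m. j < m \<longrightarrow> m \<le> l \<longrightarrow> adequate \<sigma> Q (snd (c j)) (snd (c m)) \<and>
        below (fst (c m)) (snd (c m)) \<subseteq> below (fst (c j)) (snd (c j)) \<and>
        (\<exists>z\<in>univ M. z \<in> below (fst (c j)) (snd (c j)) \<and> z \<notin> below (fst (c m)) (snd (c m))))"

text \<open>Two cuts with equal pairs of profiles would give a model with fewer nodes.\<close>

lemma inj_profiles:
  assumes c: "cut_chain Q l c"
  shows "inj_on (\<lambda>j. (outs Q (c j), ins Q (c j))) {..l}"
proof -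
  have False if jm: "j < m" "m \<le> l" and eq: "outs Q (c j) = outs Q (c m)" "ins Q (c j) = ins Q (c m)"
    for j m
  proof -
    have cj: "fst (c j) \<in> univ M" "snd (c j) > 0 \<Longrightarrow> fst (c j) @ [snd (c j) - 1] \<in> univ M"
      using c jm unfolding cut_chain_def by auto
    have "adequate \<sigma> Q (snd (c j)) (snd (c m))"
      and sub: "below (fst (c m)) (snd (c m)) \<subseteq> below (fst (c j)) (snd (c j))"
      and "\<exists>z\<in>univ M. z \<in> below (fst (c j)) (snd (c j)) \<and> z \<notin> below (fst (c m)) (snd (c m))"
      using c jm unfolding cut_chain_def by blast+
    then obtain z where z: "z \<in> univ M" "z \<in> below (fst (c j)) (snd (c j))"
      "z \<notin> below (fst (c m)) (snd (c m))" by blast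
    interpret cut M "vars \<phi>" "subs \<phi>" \<sigma> Q "fst (c j)" "fst (c m)" "snd (c j)" "snd (c m)"
      by unfold_locales (fact tree cj sub eq \<open>adequate _ _ _ _\<close>)+
    show False
      using minimal[OF tree_model_M'[OF F1 order_refl order_refl model]] card_M'[OF z] by simp
  qed
  then show ?thesis by (intro linorder_inj_onI) auto
qed

lemma card_T: "card T \<le> 2 ^ (6 * (fo_length \<phi>)\<^sup>2 + 5 * fo_length \<phi>)"
  by (intro card_qf_types finite_vars finite_subs card_vars card_subs)

lemma chain_length:
  assumes "cut_chain Q l c"
  shows "Suc l \<le> 2 ^ 2 ^ (6 * (fo_length \<phi>)\<^sup>2 + 5 * fo_length \<phi> + 1)"
proof -
  have "Suc l \<le> 2 ^ (2 * card T)"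
    by (rule pair_chain_length[OF _ _ _ inj_profiles[OF assms]])
      (auto simp: finite_qf_types finite_vars finite_subs profile_subset)
  also have "\<dots> \<le> 2 ^ 2 ^ (6 * (fo_length \<phi>)\<^sup>2 + 5 * fo_length \<phi> + 1)"
    using card_T by (intro power_increasing) auto
  finally show ?thesis .
qed

text \<open>The forests shrink along the chain. With stable marks, outer tuples remain outer tuples
  of the same type and later inner tuples are earlier ones, so outer profiles grow and inner
  profiles shrink.\<close>

lemma monotone_chain_length:
  assumes "cut_chain Q l c"
    and out: "\<And>j m a q. j < m \<Longrightarrow> m \<le> l \<Longrightarrow> q \<in> Q \<Longrightarrow> a \<in> univ M \<Longrightarrow>
      a \<notin> below (fst (c j)) (snd (c j)) \<Longrightarrow>
      mark_holds (fst (c j)) (snd (c j)) q a \<longleftrightarrow> mark_holds (fst (c m)) (snd (c m)) q a"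
    and inn: "\<And>j m a q. j < m \<Longrightarrow> m \<le> l \<Longrightarrow> q \<in> Q \<Longrightarrow> a \<in> below (fst (c m)) (snd (c m)) \<Longrightarrow>
      mark_holds (fst (c j)) (snd (c j)) q a \<longleftrightarrow> mark_holds (fst (c m)) (snd (c m)) q a"
  shows "Suc l \<le> 2 ^ (6 * (fo_length \<phi>)\<^sup>2 + 5 * fo_length \<phi> + 2)"
proof -
  have sub: "below (fst (c m)) (snd (c m)) \<subseteq> below (fst (c j)) (snd (c j))"
    if "j < m" "m \<le> l" for j m
    using assms(1) that unfolding cut_chain_def by blast
  have "l \<le> 2 * card T"
  proof (rule monotone_pair_chain_length[OF _ _ _ inj_profiles[OF assms(1)]])
    fix j m assume jm: "j < m" "m \<le> l"
    show "outs Q (c j) \<subseteq> outs Q (c m)"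
      using sub[OF jm] out[OF jm] by (intro profile_mono) (auto simp: outer_def)
    show "ins Q (c m) \<subseteq> ins Q (c j)"
      using sub[OF jm] inn[OF jm] by (intro profile_mono) (auto simp: inner_def)
  qed (auto simp: finite_qf_types finite_vars finite_subs profile_subset)
  also have "\<dots> \<le> 2 * 2 ^ (6 * (fo_length \<phi>)\<^sup>2 + 5 * fo_length \<phi>)"
    using card_T by (rule mult_le_mono2)
  finally have "Suc l \<le> 1 + 2 * 2 ^ (6 * (fo_length \<phi>)\<^sup>2 + 5 * fo_length \<phi>)"
    by (simp only: plus_1_eq_Suc Suc_le_mono)
  \<comment> \<open>One factor 2 counts the two profiles; this second doubling absorbs the summand
    1.\<close>
  also have "\<dots> \<le> 2 * 2 ^ (6 * (fo_length \<phi>)\<^sup>2 + 5 * fo_length \<phi>) +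
      2 * 2 ^ (6 * (fo_length \<phi>)\<^sup>2 + 5 * fo_length \<phi>)"
    by simp
  also have "\<dots> = 2 ^ (6 * (fo_length \<phi>)\<^sup>2 + 5 * fo_length \<phi> + 2)"
    by simp
  finally show ?thesis .
qed

section \<open>Bounds for vertical and horizontal paths\<close>

lemma vertical_cut_chain:
  assumes "w \<in> univ M" and Q: "adequate \<sigma> Q 0 0"
  shows "cut_chain Q (length w) (\<lambda>j. (take j w, 0))"
proof -
  have taken: "take m w \<in> univ M" for m
    using prefix_closed assms(1) take_is_prefix by blast
  have below: "below (take m w) 0 \<subseteq> below (take j w) 0" "take m w \<in> below (take j w) 0"
    if jm: "j < m" "m \<le> length w" for j m
  proof -
    have "take m w = take j w @ drop j (take m w)"
      using append_take_drop_id[of j "take m w"] jm by (simp add: min_def)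
    moreover obtain n \<gamma> where "drop j (take m w) = n # \<gamma>"
      using jm by (cases "drop j (take m w)") auto
    ultimately have eq: "take m w = take j w @ n # \<gamma>" by simp
    show "below (take m w) 0 \<subseteq> below (take j w) 0" "take m w \<in> below (take j w) 0"
      unfolding eq by (auto simp: below_def)
  qed
  show ?thesis
    unfolding cut_chain_def fst_conv snd_conv
  proof (intro conjI allI impI)
    fix j m assume jm: "j < m" "m \<le> length w"
    \<comment> \<open>The node at the later cut separates: it lies in the earlier forest but not in
      its own.\<close>
    show "\<exists>z\<in>univ M. z \<in> below (take j w) 0 \<and> z \<notin> below (take m w) 0"
      using taken[of m] below(2)[OF jm] self_notin_below by (intro bexI[of _ "take m w"] conjI)
  qed (use taken Q below(1) in simp_all)
qed

lemma horizontal_cut_chain: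
  assumes "\<alpha> \<in> univ M" "\<forall>i\<le>l. \<alpha> @ [i] \<in> univ M" "\<And>i j. adequate \<sigma> Q i j"
  shows "cut_chain Q l (\<lambda>j. (\<alpha>, j))"
  unfolding cut_chain_def
proof (intro conjI allI impI)
  fix j m assume jm: "j < m" "m \<le> l"
  show "below (fst (\<alpha>, m)) (snd (\<alpha>, m)) \<subseteq> below (fst (\<alpha>, j)) (snd (\<alpha>, j))"
    using jm by (auto simp: below_def)
  \<comment> \<open>The child with index \<open>j\<close> drops out of every later forest.\<close>
  show "\<exists>z\<in>univ M. z \<in> below (fst (\<alpha>, j)) (snd (\<alpha>, j)) \<and> z \<notin> below (fst (\<alpha>, m)) (snd (\<alpha>, m))"
    using jm assms(2) by (intro bexI[of _ "\<alpha> @ [j]"]) auto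
qed (use assms in auto)

lemma vertical_path_chain:
  assumes "vertical_path M ps"
  obtains w where "w \<in> univ M" "length ps = Suc (length w)"
  using assms unfolding vertical_path_def leaf_def by auto

lemma horizontal_path_chain:
  assumes "horizontal_path M ps"
  obtains \<alpha> l where "\<alpha> \<in> univ M" "\<forall>i\<le>l. \<alpha> @ [i] \<in> univ M" "length ps = Suc l"
proof -
  obtain \<alpha> l where *: "\<alpha> \<in> univ M" "ps = map (\<lambda>i. \<alpha> @ [i]) [0..<l + 1]"
    "set ps = {b \<in> univ M. nav_rel Child \<alpha> b}"
    using assms unfolding horizontal_path_def by blast
  have "\<alpha> @ [i] \<in> set ps" if "i \<le> l" for i
    using that by (auto simp: *(2))
  then have "\<forall>i\<le>l. \<alpha> @ [i] \<in> univ M" using *(3) by blast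
  moreover have "length ps = Suc l" by (simp add: *(2))
  ultimately show ?thesis using that *(1) by blast
qed

text \<open>The set of all marks is adequate for every signature.\<close>

lemma vertical_double: "vertical_bounded M (2 ^ 2 ^ (6 * (fo_length \<phi>)\<^sup>2 + 5 * fo_length \<phi> + 1))"
  unfolding vertical_bounded_def
proof (intro allI impI)
  fix ps assume "vertical_path M ps"
  then obtain w where "w \<in> univ M" "length ps = Suc (length w)" by (rule vertical_path_chain)
  then show "length ps \<le> 2 ^ 2 ^ (6 * (fo_length \<phi>)\<^sup>2 + 5 * fo_length \<phi> + 1)"
    using chain_length[OF vertical_cut_chain[of w UNIV]] by (simp add: adequate_def)
qed

lemma horizontal_double: "horizontal_bounded M (2 ^ 2 ^ (6 * (fo_length \<phi>)\<^sup>2 + 5 * fo_length \<phi> + 1))"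
  unfolding horizontal_bounded_def
proof (intro allI impI)
  fix ps assume "horizontal_path M ps"
  then obtain \<alpha> l where "\<alpha> \<in> univ M" "\<forall>i\<le>l. \<alpha> @ [i] \<in> univ M" "length ps = Suc l"
    by (rule horizontal_path_chain)
  then show "length ps \<le> 2 ^ 2 ^ (6 * (fo_length \<phi>)\<^sup>2 + 5 * fo_length \<phi> + 1)"
    using chain_length[OF horizontal_cut_chain[of \<alpha> l UNIV]] by (simp add: adequate_def)
qed

text \<open>Without \<open>Child\<close> the ancestor mark suffices even for the sibling relations, because a cut
  \<open>(\<alpha>, 0)\<close> leaves no child of \<open>\<alpha>\<close> outside.\<close>

lemma vertical_single:
  assumes "Child \<notin> \<sigma>"
  shows "vertical_bounded M (2 ^ (6 * (fo_length \<phi>)\<^sup>2 + 5 * fo_length \<phi> + 2))"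
  unfolding vertical_bounded_def
proof (intro allI impI)
  fix ps assume "vertical_path M ps"
  then obtain w where w: "w \<in> univ M" "length ps = Suc (length w)" by (rule vertical_path_chain)
  have "cut_chain {Anc} (length w) (\<lambda>j. (take j w, 0))"
    using assms by (intro vertical_cut_chain w) (simp add: adequate_def)
  then have "Suc (length w) \<le> 2 ^ (6 * (fo_length \<phi>)\<^sup>2 + 5 * fo_length \<phi> + 2)"
  proof (rule monotone_chain_length)
    fix j m a q
    assume jm: "j < m" "m \<le> length w" and q: "q \<in> {Anc}"
    have pre: "prefix (take j w) (take m w)"
      using jm by (metis less_imp_le min_def take_is_prefix take_take)
    have strict: "a \<in> below (take j w) 0" if "strict_prefix (take j w) a" for a
      using that by (cases rule: strict_prefixE') (auto simp: below_def)
    {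
      assume "a \<notin> below (fst (take j w, 0)) (snd (take j w, 0))"
      then have "\<not> strict_prefix (take j w) a" using strict by auto
      \<comment> \<open>A prefix of \<open>take m w\<close> is comparable with
        \<open>take j w\<close>, and a proper extension of \<open>take j w\<close> would lie in the
        forest.\<close>
      then have "prefix a (take j w) \<longleftrightarrow> prefix a (take m w)"
        using pre prefix_same_cases prefix_order.trans strict_prefixI by metis
      then show "mark_holds (fst (take j w, 0)) (snd (take j w, 0)) q a \<longleftrightarrow>
          mark_holds (fst (take m w, 0)) (snd (take m w, 0)) q a"
        using q by simp
    }
    {
      assume "a \<in> below (fst (take m w, 0)) (snd (take m w, 0))"
      then have "\<not> prefix a (take m w)" by (auto simp: below_def prefix_def)
      moreover from this have "\<not> prefix a (take j w)"
        using pre prefix_order.trans by blast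
      ultimately show "mark_holds (fst (take j w, 0)) (snd (take j w, 0)) q a \<longleftrightarrow>
          mark_holds (fst (take m w, 0)) (snd (take m w, 0)) q a"
        using q by simp
    }
  qed
  then show "length ps \<le> 2 ^ (6 * (fo_length \<phi>)\<^sup>2 + 5 * fo_length \<phi> + 2)" using w by simp
qed

text \<open>Without \<open>NextSib\<close> the marks \<open>Anc\<close>, \<open>Par\<close> and
  \<open>Sib\<close> are adequate. They depend on \<open>\<alpha>\<close> but not on the index of
  the cut, hence are stable among siblings.\<close>

lemma horizontal_single:
  assumes "NextSib \<notin> \<sigma>"
  shows "horizontal_bounded M (2 ^ (6 * (fo_length \<phi>)\<^sup>2 + 5 * fo_length \<phi> + 2))"
  unfolding horizontal_bounded_def
proof (intro allI impI)
  fix ps assume "horizontal_path M ps"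
  then obtain \<alpha> l where l: "\<alpha> \<in> univ M" "\<forall>i\<le>l. \<alpha> @ [i] \<in> univ M" "length ps = Suc l"
    by (rule horizontal_path_chain)
  have "cut_chain {Anc, Par, Sib} l (\<lambda>j. (\<alpha>, j))"
    using assms by (intro horizontal_cut_chain l) (simp_all add: adequate_def)
  then have "Suc l \<le> 2 ^ (6 * (fo_length \<phi>)\<^sup>2 + 5 * fo_length \<phi> + 2)"
    by (rule monotone_chain_length) auto
  then show "length ps \<le> 2 ^ (6 * (fo_length \<phi>)\<^sup>2 + 5 * fo_length \<phi> + 2)" using l by simp
qed

end

section \<open>Existence of minimal models and the four bounds\<close>

lemma minimal_model_exists:
  assumes "\<phi> \<in> F1 \<sigma>" "satisfiable_over_trees \<phi>"
  obtains M where "minimal_model \<sigma> \<phi> M"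
proof -
  obtain M0 where "tree_model M0 \<phi>" using assms(2) unfolding satisfiable_over_trees_def by blast
  then obtain M where "tree_model M \<phi>" "\<forall>N. tree_model N \<phi> \<longrightarrow> card (univ M) \<le> card (univ N)"
    using ex_has_least_nat[of "\<lambda>M. tree_model M \<phi>" M0 "\<lambda>M. card (univ M)"] by blast
  then show ?thesis using assms(1) by (intro that) (simp add: minimal_model_def)
qed

theorem theorem6p9:
  "\<exists>(g :: nat \<Rightarrow> nat) (f :: nat \<Rightarrow> nat).
     doubly_exponential g \<and> singly_exponential f \<and>
     (\<forall>\<sigma> \<phi>. \<sigma> \<subseteq> {Child, Desc, NextSib, FollSib} \<longrightarrow>
        \<phi> \<in> F1 \<sigma> \<longrightarrow> satisfiable_over_trees \<phi> \<longrightarrow>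
        (\<exists>M. tree_model M \<phi> \<and> horizontal_bounded M (g (fo_length \<phi>))
             \<and> vertical_bounded M (g (fo_length \<phi>)))) \<and>
     (\<forall>\<phi> \<in> F1 {Child, Desc, FollSib}. satisfiable_over_trees \<phi> \<longrightarrow>
        (\<exists>M. tree_model M \<phi> \<and> horizontal_bounded M (f (fo_length \<phi>))
             \<and> vertical_bounded M (g (fo_length \<phi>)))) \<and>
     (\<forall>\<phi> \<in> F1 {Desc, NextSib, FollSib}. satisfiable_over_trees \<phi> \<longrightarrow>
        (\<exists>M. tree_model M \<phi> \<and> vertical_bounded M (f (fo_length \<phi>))
             \<and> horizontal_bounded M (g (fo_length \<phi>)))) \<and>
     (\<forall>\<phi> \<in> F1 {Desc, FollSib}. satisfiable_over_trees \<phi> \<longrightarrow>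
        (\<exists>M. tree_model M \<phi> \<and> vertical_bounded M (f (fo_length \<phi>))
             \<and> horizontal_bounded M (f (fo_length \<phi>))))"
proof -
  \<comment> \<open>The values are the lengths allowed by \<open>chain_length\<close> for
    \<open>g\<close> and by \<open>monotone_chain_length\<close> for \<open>f\<close>.\<close>
  define g :: "nat \<Rightarrow> nat" where "g n = 2 ^ 2 ^ (6 * n\<^sup>2 + 5 * n + 1)" for n
  define f :: "nat \<Rightarrow> nat" where "f n = 2 ^ (6 * n\<^sup>2 + 5 * n + 2)" for n
  have "g n \<le> 2 ^ 2 ^ poly [:1, 5, 6:] n" "f n \<le> 2 ^ poly [:2, 5, 6:] n" for n
    unfolding g_def f_def by (intro power_increasing; simp add: power2_eq_square algebra_simps)+
  then have exps: "doubly_exponential g" "singly_exponential f"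
    unfolding doubly_exponential_def singly_exponential_def by blast+
  \<comment> \<open>A single minimal model meets all these bounds; each part of the theorem selects
    those for its signature.\<close>
  have model: "\<exists>M. tree_model M \<phi> \<and> horizontal_bounded M (g (fo_length \<phi>)) \<and>
      vertical_bounded M (g (fo_length \<phi>)) \<and>
      (NextSib \<notin> \<sigma> \<longrightarrow> horizontal_bounded M (f (fo_length \<phi>))) \<and>
      (Child \<notin> \<sigma> \<longrightarrow> vertical_bounded M (f (fo_length \<phi>)))"
    if sat: "\<phi> \<in> F1 \<sigma>" "satisfiable_over_trees \<phi>" for \<phi> \<sigma>
  proof -
    obtain M where "minimal_model \<sigma> \<phi> M" using sat by (rule minimal_model_exists)
    then interpret minimal_model \<sigma> \<phi> M .
    show ?thesis
      unfolding g_def f_def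
      using model horizontal_double vertical_double horizontal_single vertical_single
      by (intro exI[of _ M] conjI impI)
  qed
  note exps
  moreover have "\<forall>\<sigma> \<phi>. \<sigma> \<subseteq> {Child, Desc, NextSib, FollSib} \<longrightarrow>
        \<phi> \<in> F1 \<sigma> \<longrightarrow> satisfiable_over_trees \<phi> \<longrightarrow>
        (\<exists>M. tree_model M \<phi> \<and> horizontal_bounded M (g (fo_length \<phi>))
             \<and> vertical_bounded M (g (fo_length \<phi>)))"
    using model by blast
  moreover have "\<forall>\<phi> \<in> F1 {Child, Desc, FollSib}. satisfiable_over_trees \<phi> \<longrightarrow>
        (\<exists>M. tree_model M \<phi> \<and> horizontal_bounded M (f (fo_length \<phi>))
             \<and> vertical_bounded M (g (fo_length \<phi>)))"
    using model[of _ "{Child, Desc, FollSib}"] by auto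
  moreover have "\<forall>\<phi> \<in> F1 {Desc, NextSib, FollSib}. satisfiable_over_trees \<phi> \<longrightarrow>
        (\<exists>M. tree_model M \<phi> \<and> vertical_bounded M (f (fo_length \<phi>))
             \<and> horizontal_bounded M (g (fo_length \<phi>)))"
    using model[of _ "{Desc, NextSib, FollSib}"] by auto
  moreover have "\<forall>\<phi> \<in> F1 {Desc, FollSib}. satisfiable_over_trees \<phi> \<longrightarrow>
        (\<exists>M. tree_model M \<phi> \<and> vertical_bounded M (f (fo_length \<phi>))
             \<and> horizontal_bounded M (f (fo_length \<phi>)))"
    using model[of _ "{Desc, FollSib}"] by auto
  ultimately show ?thesis by (intro exI[of _ g] exI[of _ f] conjI)
qed

end
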